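(* Consider the full shift $\mathcal A^{\mathbb N}$ on a finite alphabet $\mathcal A$ with at least two letters, and a subshift $\mathbb K\subset\mathcal A^{\mathbb N}$ of zero entropy. Consider a cylinder $J$ such that $J\cap\mathbb K=\emptyset$. Assume there exists $\beta_0>0$ such that $\mathcal L_{0,\beta_0,V_0}(\mathbf 1_J)(x)<1$ holds for all $x\in J$. Then for every $\beta\ge\beta_0$, every equilibrium measure for the potential $V_0$ gives zero measure to $J$. Moreover, if the subshift $\mathbb K$ is minimal and uniquely ergodic, with unique invariant probability measure $\mu_{\mathbb K}$, then $\beta_0$ is independent of $J$, then $\mu_{\mathbb K}$ is the unique equilibrium state, and thus $P(\beta)=0$ for $\beta\ge\beta_0$.
   Context: $\sigma$ is the shift on the full shift $\mathcal A^{\mathbb N}$, $\sigma(u)_n=u_{n+1}$; the distance is $d(x,y)=2^{-n}$ with $n=\min\{i\ge0:x_i\ne y_i\}$ for $x\neq y$, and $d(x,\mathbb K)=\inf_{y\in\mathbb K}d(x,y)$. A subshift is a nonempty closed $\sigma$-invariant subset of $\mathcal A^{\mathbb N}$; it is minimal if every $\sigma$-orbit of one of its elements is dense in it, and uniquely ergodic if it has only one $\sigma$-invariant probability measure. A cylinder is the set of all infinite words having a given finite word as prefix. The potential $V_0=-\varphi_0$ is given by $\varphi_0(x)=\log\left(1+\frac{1}{n+1}\right)$ if $d(x,\mathbb K)=2^{-n}$, and $\varphi_0(x)=0$ if $x\in\mathbb K$. For $\beta\ge 0$, $P(\beta)=\sup\{h_\mu+\beta\int V_0\,d\mu\}$,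 the supremum being over all $\sigma$-invariant probability measures $\mu$ on the full shift $\mathcal A^{\mathbb N}$ ($h_\mu$ is the Kolmogorov entropy). An equilibrium measure (equilibrium state) at $\beta$ is a measure realizing this supremum. For $y\in J$ let $\tau(y)=\min\{n\ge1:\sigma^n(y)\in J\}$ be the first return time to $J$ (not defined everywhere). For $z\in\mathbb R$, $\beta>0$, a potential $V$ and a continuous function $g:J\to\mathbb R$, the induced transfer operator is $$\mathcal L_{z,\beta,V}(g)(x)=\sum_{n\in\mathbb N}\ \sum_{\substack{y\in J,\ \tau(y)=n\\ \sigma^n(y)=x}}e^{\beta (S_nV)(y)-nz}g(y),\qquad (S_nV)(y)=\sum_{k=0}^{n-1}V(\sigma^k(y)).$$ $\mathbf 1_J$ denotes the indicator function of $J$; for $g=\mathbf 1_J$ the sum has nonnegative terms and takes its value in $[0,+\infty]$. *)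

theory Defs
  imports "HOL-Probability.Probability"
begin

section \<open>The one-sided full shift\<close>

type_synonym 'a seq = "nat \<Rightarrow> 'a"

definition shift :: "'a seq \<Rightarrow> 'a seq" where
  "shift u = (\<lambda>n. u (Suc n))"

definition seq_dist :: "'a seq \<Rightarrow> 'a seq \<Rightarrow> real" where
  "seq_dist x y = (if x = y then 0 else (1/2) ^ (LEAST i. x i \<noteq> y i))"

lemma Metric_space_seq_dist: "Metric_space UNIV seq_dist"
proof
  fix x y z :: "'a seq"
  show "0 \<le> seq_dist x y" by (simp add: seq_dist_def)
  show "seq_dist x y = seq_dist y x"
    by (simp add: seq_dist_def eq_commute)
  show "(seq_dist x y = 0) = (x = y)" by (simp add: seq_dist_def)
  show "seq_dist x z \<le> seq_dist x y + seq_dist y z"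
  proof (cases "x = y \<or> y = z \<or> x = z")
    case True
    then show ?thesis by (auto simp: seq_dist_def)
  next
    case False
    define i where "i = (LEAST i. x i \<noteq> z i)"
    have "\<exists>i. x i \<noteq> z i" using False by (auto simp: fun_eq_iff)
    then have "x i \<noteq> z i" unfolding i_def by (rule LeastI_ex)
    then have "x i \<noteq> y i \<or> y i \<noteq> z i" by auto
    then have "(LEAST i. x i \<noteq> y i) \<le> i \<or> (LEAST i. y i \<noteq> z i) \<le> i"
      by (auto intro: Least_le)
    then have "(1/2 :: real) ^ i \<le> (1/2) ^ (LEAST i. x i \<noteq> y i)
        \<or> (1/2 :: real) ^ i \<le> (1/2) ^ (LEAST i. y i \<noteq> z i)"
      by (auto intro: power_decreasing)
    moreover have "0 \<le> (1/2 :: real) ^ (LEAST i. x i \<noteq> y i)"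
      and "0 \<le> (1/2 :: real) ^ (LEAST i. y i \<noteq> z i)" by simp_all
    ultimately show ?thesis using False
      unfolding seq_dist_def i_def[symmetric] by (simp only: if_False de_Morgan_disj) linarith
  qed
qed

definition seq_topology :: "'a seq topology" where
  "seq_topology = Metric_space.mtopology UNIV seq_dist"

definition seq_borel :: "'a seq measure" where
  "seq_borel = sigma UNIV {U. openin seq_topology U}"

definition dist_to :: "'a seq \<Rightarrow> 'a seq set \<Rightarrow> real" where
  "dist_to x K = (INF y\<in>K. seq_dist x y)"

definition cylinder :: "'a list \<Rightarrow> 'a seq set" where
  "cylinder w = {x. map x [0..<length w] = w}"


section \<open>Subshifts\<close>

definition subshift :: "'a seq set \<Rightarrow> bool" where
  "subshift K \<longleftrightarrow> K \<noteq> {} \<and> closedin seq_topology K \<and> shift ` K \<subseteq> K"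

definition minimal_subshift :: "'a seq set \<Rightarrow> bool" where
  "minimal_subshift K \<longleftrightarrow>
     subshift K \<and> (\<forall>x\<in>K. K \<subseteq> seq_topology closure_of {(shift ^^ n) x | n. True})"

definition factors :: "'a seq set \<Rightarrow> nat \<Rightarrow> 'a list set" where
  "factors K n = {map x [k..<k + n] | x k. x \<in> K}"

text \<open>The sequence of logarithms is subadditive, so the upper limit below is a limit.\<close>

definition subshift_entropy :: "'a seq set \<Rightarrow> ereal" where
  "subshift_entropy K = limsup (\<lambda>n. ereal (ln (real (card (factors K n))) / real n))"


section \<open>Invariant measures and Kolmogorov entropy\<close>

definition invariant_measure :: "'a seq measure \<Rightarrow> bool" where
  "invariant_measure \<mu> \<longleftrightarrow>
     prob_space \<mu> \<and> sets \<mu> = sets seq_borel \<and> distr \<mu> \<mu> shift = \<mu>"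

text \<open>Invariant measures of a subshift \<open>K\<close> are identified with the invariant measures of the
  full shift that are carried by \<open>K\<close>.\<close>

definition invariant_measure_on :: "'a seq set \<Rightarrow> 'a seq measure \<Rightarrow> bool" where
  "invariant_measure_on K \<mu> \<longleftrightarrow> invariant_measure \<mu> \<and> emeasure \<mu> K = 1"

definition uniquely_ergodic :: "'a seq set \<Rightarrow> bool" where
  "uniquely_ergodic K \<longleftrightarrow> (\<exists>!\<mu>. invariant_measure_on K \<mu>)"

definition finite_partition :: "'a seq measure \<Rightarrow> 'a seq set set \<Rightarrow> bool" where
  "finite_partition \<mu> P \<longleftrightarrow> finite P \<and> partition_on UNIV P \<and> P \<subseteq> sets \<mu>"

text \<open>The join of the preimages of \<open>P\<close> under the first \<open>n\<close> iterates of the shift.\<close>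

definition dynamical_join :: "nat \<Rightarrow> 'a seq set set \<Rightarrow> 'a seq set set" where
  "dynamical_join n P = {\<Inter>i<n. (shift ^^ i) -` A i | A. \<forall>i<n. A i \<in> P} - {{}}"

text \<open>Recall that \<open>ln 0 = 0\<close>, so atoms of measure zero contribute nothing.\<close>

definition partition_entropy :: "'a seq measure \<Rightarrow> 'a seq set set \<Rightarrow> real" where
  "partition_entropy \<mu> P = (\<Sum>A\<in>P. - (measure \<mu> A * ln (measure \<mu> A)))"

text \<open>Again the upper limit is a limit, by subadditivity.\<close>

definition kolmogorov_entropy :: "'a seq measure \<Rightarrow> ereal" where
  "kolmogorov_entropy \<mu> =
     (SUP P\<in>{P. finite_partition \<mu> P}.
        limsup (\<lambda>n. ereal (partition_entropy \<mu> (dynamical_join n P) / real n)))"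


section \<open>Pressure and equilibrium measures\<close>

definition free_energy :: "('a seq \<Rightarrow> real) \<Rightarrow> real \<Rightarrow> 'a seq measure \<Rightarrow> ereal" where
  "free_energy V \<beta> \<mu> = kolmogorov_entropy \<mu> + ereal (\<beta> * (\<integral>x. V x \<partial>\<mu>))"

definition pressure :: "('a seq \<Rightarrow> real) \<Rightarrow> real \<Rightarrow> ereal" where
  "pressure V \<beta> = (SUP \<mu>\<in>{\<mu>. invariant_measure \<mu>}. free_energy V \<beta> \<mu>)"

definition equilibrium_measure :: "('a seq \<Rightarrow> real) \<Rightarrow> real \<Rightarrow> 'a seq measure \<Rightarrow> bool" where
  "equilibrium_measure V \<beta> \<mu> \<longleftrightarrow>
     invariant_measure \<mu> \<and> free_energy V \<beta> \<mu> = pressure V \<beta>"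

text \<open>For closed \<open>K\<close> and \<open>x \<notin> K\<close> the distance to \<open>K\<close> is attained, hence it is \<open>(1/2) ^ n\<close> for
  exactly one \<open>n\<close>.\<close>

definition \<phi>\<^sub>0 :: "'a seq set \<Rightarrow> 'a seq \<Rightarrow> real" where
  "\<phi>\<^sub>0 K x = (if x \<in> K then 0
     else ln (1 + 1 / (real (THE n. dist_to x K = (1/2) ^ n) + 1)))"

definition V\<^sub>0 :: "'a seq set \<Rightarrow> 'a seq \<Rightarrow> real" where
  "V\<^sub>0 K x = - \<phi>\<^sub>0 K x"


section \<open>The induced transfer operator\<close>

definition birkhoff_sum :: "nat \<Rightarrow> ('a seq \<Rightarrow> real) \<Rightarrow> 'a seq \<Rightarrow> real" where
  "birkhoff_sum n V y = (\<Sum>k<n. V ((shift ^^ k) y))"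

definition return_time :: "'a seq set \<Rightarrow> 'a seq \<Rightarrow> nat option" where
  "return_time J y =
     (if \<exists>n\<ge>1. (shift ^^ n) y \<in> J then Some (LEAST n. n \<ge> 1 \<and> (shift ^^ n) y \<in> J) else None)"

text \<open>The operator acts here on \<open>[0, \<infinity>]\<close>-valued functions, for which the series always makes
  sense. The inner sum is finite when the alphabet is finite: a point has finitely many preimages
  under an iterate of the shift.\<close>

definition induced_transfer ::
  "'a seq set \<Rightarrow> real \<Rightarrow> real \<Rightarrow> ('a seq \<Rightarrow> real) \<Rightarrow> ('a seq \<Rightarrow> ennreal) \<Rightarrow> 'a seq \<Rightarrow> ennreal" where
  "induced_transfer J z \<beta> V g x =
     (\<Sum>n. \<Sum>y\<in>{y\<in>J. return_time J y = Some n \<and> (shift ^^ n) y = x}.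
        ennreal (exp (\<beta> * birkhoff_sum n V y - real n * z)) * g y)"

end

theory Submission
  imports Defs "HOL-Real_Asymp.Real_Asymp"
begin

text \<open>
  Let \<open>J\<close> be the cylinder of a word \<open>w\<close> and suppose that \<open>J\<close> does not meet \<open>K\<close>. The point of the proof is
  that \<open>J\<close> screens the potential: for \<open>x \<in> J\<close> the longest prefix of \<open>u x\<close> that occurs in \<open>K\<close> ends
  before \<open>u w\<close> does, so \<open>V\<^sub>0 (u x)\<close> depends on \<open>u\<close> only. Hence the sum \<open>f\<^sub>k\<close> of the weights of all first
  returns of length \<open>k\<close> to \<open>x \<in> J\<close> is the same for all \<open>x\<close>, and the sums \<open>u\<^sub>n\<close> over all returns of
  length \<open>n\<close> satisfy a renewal equation (\<open>return_sum_renewal\<close>). The hypothesis on the induced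
  operator says that \<open>\<Sum>k. f\<^sub>k < 1\<close>, that is, that this renewal process is transient.

  First, the strict inequality leaves room for a bonus: with \<open>g = \<beta>\<^sub>0 V\<^sub>0 + s 1\<^sub>J\<close> in place of
  \<open>\<beta>\<^sub>0 V\<^sub>0\<close>, each \<open>f\<^sub>k\<close> is multiplied by \<open>exp s\<close>, and for small \<open>s > 0\<close> the sum still does not exceed
  one; so the \<open>u\<^sub>n\<close> are bounded. Any word becomes a return when \<open>w\<close> is written in front of it and a
  point of \<open>J\<close> behind it, and changing the continuation of an orbit segment of length \<open>n\<close> changes its
  weight at most by a polynomial factor in \<open>n\<close> (\<open>birkhoff_sum_phi_shadow\<close>). Hence the partition
  functions of \<open>g\<close> grow at most polynomially, and the variational inequality
  (\<open>kolmogorov_entropy_le\<close>) yields \<open>h\<^sub>\<mu> + \<integral> g d\<mu> \<le> 0\<close>: the free energy of every invariant measure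
  \<open>\<mu>\<close> is at most \<open>- s \<mu>(J)\<close>. On the other hand, the pressure is at least \<open>0\<close>, because periodic orbits
  that follow a point of \<open>K\<close> for a long time have free energy close to \<open>0\<close> (\<open>pressure_nonneg\<close>). So
  an equilibrium measure does not charge \<open>J\<close>, and the pressure vanishes.

  Second, transience does not depend on the cylinder: a return to another cylinder off \<open>K\<close> is turned
  into a return to \<open>J\<close> by attaching boundedly many letters, so its return sums are summable too, and by the
  converse part of the renewal argument its first return sums add up to less than one
  (\<open>induced_transfer_less_1_other_cylinder\<close>). Therefore an equilibrium measure vanishes on all cylinders off
  \<open>K\<close>. It is then carried by \<open>K\<close>, and unique ergodicity identifies it.

  The variational inequality is needed for the entropy of arbitrary finite measurable partitions. It is
  obtained from a single application of the Gibbs inequality to the pair formed by the label sequence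
  of a point and a slightly longer initial word, which predicts these labels up to a small error.
\<close>

section \<open>Words and the shift\<close>

definition initial :: "nat \<Rightarrow> 'a seq \<Rightarrow> 'a list" where
  "initial n x = map x [0..<n]"

definition prepend :: "'a list \<Rightarrow> 'a seq \<Rightarrow> 'a seq" where
  "prepend u x = (\<lambda>i. if i < length u then u ! i else x (i - length u))"

definition words :: "nat \<Rightarrow> 'a list set" where
  "words n = {u. length u = n}"

lemma shift_funpow: "(shift ^^ n) x = (\<lambda>i. x (i + n))"
  by (induction n) (simp_all add: shift_def)

lemma length_initial [simp]: "length (initial n x) = n"
  by (simp add: initial_def)

lemma initial_in_words [simp]: "initial n x \<in> words n"
  by (simp add: words_def)

lemma finite_words [simp]: "finite (words n :: 'a::finite list set)"
  using finite_lists_length_eq[of "UNIV :: 'a set" n] by (simp add: words_def)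

lemma initial_eq_iff: "initial n x = initial n y \<longleftrightarrow> (\<forall>i<n. x i = y i)"
  by (auto simp: initial_def)

lemma mem_cylinder_iff: "x \<in> cylinder w \<longleftrightarrow> initial (length w) x = w"
  by (simp add: cylinder_def initial_def)

lemma mem_cylinder_nth: "x \<in> cylinder w \<longleftrightarrow> (\<forall>i<length w. x i = w ! i)"
  unfolding mem_cylinder_iff list_eq_iff_nth_eq by (simp add: initial_def)

lemma mem_cylinder_cong:
  "initial n x = initial n y \<Longrightarrow> length w \<le> n \<Longrightarrow> x \<in> cylinder w \<longleftrightarrow> y \<in> cylinder w"
  unfolding mem_cylinder_nth initial_eq_iff by (metis order_less_le_trans)

lemma initial_prepend [simp]: "length u = n \<Longrightarrow> initial n (prepend u x) = u"
  by (rule nth_equalityI) (simp_all add: initial_def prepend_def)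

lemma prepend_in_cylinder [simp]: "prepend w x \<in> cylinder w"
  by (simp add: mem_cylinder_iff)

lemma prepend_append: "prepend (u @ v) x = prepend u (prepend v x)"
  by (auto simp: prepend_def fun_eq_iff nth_append)

lemma shift_funpow_prepend: "k \<le> length u \<Longrightarrow> (shift ^^ k) (prepend u x) = prepend (drop k u) x"
  by (auto simp: prepend_def shift_funpow fun_eq_iff add.commute)

lemma shift_prepend_length [simp]: "(shift ^^ length u) (prepend u x) = x"
  by (auto simp: prepend_def shift_funpow fun_eq_iff)

lemma prepend_initial_shift: "prepend (initial n x) ((shift ^^ n) x) = x"
  by (auto simp: prepend_def shift_funpow fun_eq_iff initial_def)

lemma initial_shift_cong:
  "initial n x = initial n y \<Longrightarrow> k + j \<le> n \<Longrightarrow>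
    initial j ((shift ^^ k) x) = initial j ((shift ^^ k) y)"
  by (auto simp: initial_eq_iff shift_funpow)

lemma initial_shift: "k + j \<le> n \<Longrightarrow> initial j ((shift ^^ k) x) = take j (drop k (initial n x))"
  by (auto simp: initial_def shift_funpow list_eq_iff_nth_eq add.commute)

lemma bij_betw_prepend: "bij_betw (\<lambda>u. prepend u x) (words n) {y. (shift ^^ n) y = x}"
  by (rule bij_betw_byWitness[where f' = "initial n"])
    (auto simp: words_def prepend_initial_shift)

lemma finite_preimages: "finite {y :: ('a::finite) seq. (shift ^^ n) y = x}"
  using bij_betw_finite[OF bij_betw_prepend] finite_words by blast

lemma birkhoff_sum_add:
  "birkhoff_sum (m + n) g y = birkhoff_sum m g y + birkhoff_sum n g ((shift ^^ m) y)"
proof -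
  have "(\<Sum>k<m + n. g ((shift ^^ k) y)) =
      (\<Sum>k<m. g ((shift ^^ k) y)) + (\<Sum>k<n. g ((shift ^^ (k + m)) y))"
    by (induction n) (auto simp: add_ac)
  then show ?thesis
    by (simp add: birkhoff_sum_def funpow_add)
qed

section \<open>Renewal sequences\<close>

text \<open>Probabilistically, \<open>f\<close> is the law of a possibly defective waiting time and \<open>u n\<close> the probability
that a renewal takes place at time \<open>n\<close>. As such it never exceeds one. The expected number of
renewals is finite exactly when the waiting time has mass less than one; \<open>renewal_transient\<close> and
\<open>renewal_transient_converse\<close> are the two directions.\<close>

lemma renewal_le_1:
  fixes u f :: "nat \<Rightarrow> real"
  assumes u0: "u 0 = 1" and rec: "\<And>n. u (Suc n) = (\<Sum>k\<le>n. f (Suc k) * u (n - k))"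
    and f: "\<And>n. 0 \<le> f n" and le: "\<And>n. (\<Sum>k<n. f (Suc k)) \<le> 1"
  shows "u n \<le> 1"
proof (induction n rule: less_induct)
  case (less n)
  show ?case
  proof (cases n)
    case 0
    then show ?thesis by (simp add: u0)
  next
    case (Suc m)
    have "u n \<le> (\<Sum>k\<le>m. f (Suc k) * 1)"
      unfolding Suc rec using less Suc by (intro sum_mono mult_left_mono f) auto
    also have "\<dots> \<le> 1" using le[of "Suc m"] by (simp add: lessThan_Suc_atMost)
    finally show ?thesis .
  qed
qed

lemma renewal_nonneg:
  fixes u f :: "nat \<Rightarrow> real"
  assumes u0: "u 0 = 1" and rec: "\<And>n. u (Suc n) = (\<Sum>k\<le>n. f (Suc k) * u (n - k))"
    and f: "\<And>n. 0 \<le> f n"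
  shows "0 \<le> u n"
proof (induction n rule: less_induct)
  case (less n)
  show ?case
    using less by (cases n) (auto simp: u0 rec intro!: sum_nonneg mult_nonneg_nonneg f)
qed

text \<open>A truncated form of \<open>U = 1 + F * U\<close> for the generating series. The sum over the triangle is
compared with sums over rectangles, from above for transience and from below for its converse.\<close>

lemma renewal_partial_sum:
  fixes u f :: "nat \<Rightarrow> real"
  assumes u0: "u 0 = 1" and rec: "\<And>n. u (Suc n) = (\<Sum>k\<le>n. f (Suc k) * u (n - k))"
  shows "(\<Sum>n<Suc N. u n) = 1 + (\<Sum>(i, j)\<in>{(i, j). i + j < N}. f (Suc i) * u j)"
proof -
  have "(\<Sum>n<Suc N. u n) = 1 + (\<Sum>n<N. u (Suc n))"
    by (simp add: sum.lessThan_Suc_shift u0 del: sum.lessThan_Suc)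
  also have "(\<Sum>n<N. u (Suc n)) = (\<Sum>(i, j)\<in>{(i, j). i + j < N}. f (Suc i) * u j)"
    unfolding rec by (rule sum.triangle_reindex[symmetric])
  finally show ?thesis .
qed

lemma renewal_transient:
  fixes u f :: "nat \<Rightarrow> real"
  assumes u0: "u 0 = 1" and rec: "\<And>n. u (Suc n) = (\<Sum>k\<le>n. f (Suc k) * u (n - k))"
    and f: "\<And>n. 0 \<le> f n" and le: "\<And>n. (\<Sum>k<n. f (Suc k)) \<le> q" and q: "q < 1"
  shows "summable u"
proof (rule summableI_nonneg_bounded)
  note nn = renewal_nonneg[OF u0 rec f]
  show "0 \<le> u n" for n by (rule nn)
  show "(\<Sum>n<N. u n) \<le> 1 / (1 - q)" for N
  proof (cases N)
    case 0
    then show ?thesis using q by simp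
  next
    case (Suc M)
    let ?S = "\<Sum>n<N. u n"
    have "?S = 1 + (\<Sum>(i, j)\<in>{(i, j). i + j < M}. f (Suc i) * u j)"
      unfolding Suc by (rule renewal_partial_sum[OF u0 rec])
    also have "\<dots> \<le> 1 + (\<Sum>(i, j)\<in>{..<N} \<times> {..<N}. f (Suc i) * u j)"
      using Suc f nn by (intro add_left_mono sum_mono2) (auto intro!: mult_nonneg_nonneg)
    also have "\<dots> = 1 + (\<Sum>k<N. f (Suc k)) * ?S"
      by (simp add: sum_product sum.cartesian_product)
    also have "\<dots> \<le> 1 + q * ?S"
      using le nn by (intro add_left_mono mult_right_mono sum_nonneg) auto
    finally show ?thesis using q by (simp add: field_simps)
  qed
qed

text \<open>Truncating \<open>U = 1 + F * U\<close> from below gives \<open>F * U \<le> U - 1\<close>, hence \<open>F \<le> 1 - 1 / U\<close>.\<close>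

lemma renewal_transient_converse:
  fixes u f :: "nat \<Rightarrow> real"
  assumes u0: "u 0 = 1" and rec: "\<And>n. u (Suc n) = (\<Sum>k\<le>n. f (Suc k) * u (n - k))"
    and f: "\<And>n. 0 \<le> f n" and u: "summable u"
  obtains q where "q < 1" "\<And>n. (\<Sum>k<n. f (Suc k)) \<le> q"
proof
  note nn = renewal_nonneg[OF u0 rec f]
  have "1 \<le> suminf u"
    using sum_le_suminf[OF u, of "{0}"] nn u0 by simp
  then show "1 - 1 / suminf u < 1" by simp
  fix n
  have bound: "(\<Sum>k<n. f (Suc k)) * (\<Sum>j<m. u j) \<le> suminf u - 1" for m
  proof -
    have "(\<Sum>k<n. f (Suc k)) * (\<Sum>j<m. u j) = (\<Sum>(i, j)\<in>{..<n} \<times> {..<m}. f (Suc i) * u j)"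
      by (simp add: sum_product sum.cartesian_product)
    also have "\<dots> \<le> (\<Sum>(i, j)\<in>{(i, j). i + j < n + m}. f (Suc i) * u j)"
    proof (rule sum_mono2)
      show "finite {(i :: nat, j). i + j < n + m}"
        by (rule finite_subset[of _ "{..n + m} \<times> {..n + m}"]) auto
    qed (auto intro!: mult_nonneg_nonneg f nn)
    also have "\<dots> = (\<Sum>j<Suc (n + m). u j) - 1"
      by (simp add: renewal_partial_sum[OF u0 rec, of "n + m"] del: sum.lessThan_Suc)
    also have "\<dots> \<le> suminf u - 1"
      using sum_le_suminf[OF u, of "{..<Suc (n + m)}"] nn by simp
    finally show ?thesis .
  qed
  have "(\<lambda>m. (\<Sum>k<n. f (Suc k)) * (\<Sum>j<m. u j)) \<longlonglongrightarrow> (\<Sum>k<n. f (Suc k)) * suminf u"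
    by (intro tendsto_intros summable_LIMSEQ u)
  then have "(\<Sum>k<n. f (Suc k)) * suminf u \<le> suminf u - 1"
    by (rule LIMSEQ_le_const2) (use bound in blast)
  then show "(\<Sum>k<n. f (Suc k)) \<le> 1 - 1 / suminf u"
    using \<open>1 \<le> suminf u\<close> by (simp add: field_simps)
qed

section \<open>Return sums to a cylinder\<close>

definition return_sum :: "('a seq \<Rightarrow> real) \<Rightarrow> 'a seq set \<Rightarrow> nat \<Rightarrow> 'a seq \<Rightarrow> real" where
  "return_sum g J n x = (\<Sum>y\<in>{y\<in>J. (shift ^^ n) y = x}. exp (birkhoff_sum n g y))"

definition first_return_sum :: "('a seq \<Rightarrow> real) \<Rightarrow> 'a seq set \<Rightarrow> nat \<Rightarrow> 'a seq \<Rightarrow> real" where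
  "first_return_sum g J n x =
     (\<Sum>y\<in>{y\<in>J. return_time J y = Some n \<and> (shift ^^ n) y = x}. exp (birkhoff_sum n g y))"

text \<open>A function is screened by \<open>J\<close> if, looking at a sequence from its start, it cannot see past an
occurrence of \<open>J\<close>. A word that never occurs in \<open>K\<close> screens the distance to \<open>K\<close>, and this makes
return sums independent of the point to which one returns.\<close>

definition screened :: "'a seq set \<Rightarrow> ('a seq \<Rightarrow> 'b) \<Rightarrow> bool" where
  "screened J g \<longleftrightarrow> (\<forall>u. \<forall>x\<in>J. \<forall>x'\<in>J. g (prepend u x) = g (prepend u x'))"

lemma screenedD: "screened J g \<Longrightarrow> x \<in> J \<Longrightarrow> x' \<in> J \<Longrightarrow> g (prepend u x) = g (prepend u x')"
  unfolding screened_def by blast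

lemma initial_prepend_cylinder:
  "x \<in> cylinder w \<Longrightarrow> initial (length u + length w) (prepend u x) = u @ w"
proof (rule nth_equalityI)
  assume x: "x \<in> cylinder w"
  fix i assume "i < length (initial (length u + length w) (prepend u x))"
  then have i: "i < length u + length w" by simp
  show "initial (length u + length w) (prepend u x) ! i = (u @ w) ! i"
  proof (cases "i < length u")
    case True
    with i show ?thesis by (simp add: initial_def prepend_def nth_append)
  next
    case False
    then have "x (i - length u) = w ! (i - length u)"
      using x i unfolding mem_cylinder_nth by simp
    with i False show ?thesis by (simp add: initial_def prepend_def nth_append)
  qed
qed simp

lemma screened_mem_cylinder: "screened (cylinder w) (\<lambda>x. x \<in> cylinder w)"
  unfolding screened_def
proof (intro allI ballI)
  fix u and x x' :: "'a seq"
  assume "x \<in> cylinder w" "x' \<in> cylinder w"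
  then have "initial (length u + length w) (prepend u x)
      = initial (length u + length w) (prepend u x')"
    by (simp only: initial_prepend_cylinder)
  then show "(prepend u x \<in> cylinder w) = (prepend u x' \<in> cylinder w)"
    by (rule mem_cylinder_cong) simp
qed

lemma return_time_Some_iff:
  "return_time J y = Some n \<longleftrightarrow>
     1 \<le> n \<and> (shift ^^ n) y \<in> J \<and> (\<forall>k. 1 \<le> k \<and> k < n \<longrightarrow> (shift ^^ k) y \<notin> J)"
  (is "?L \<longleftrightarrow> ?R")
proof
  assume L: ?L
  then have ex: "\<exists>n\<ge>1. (shift ^^ n) y \<in> J"
    by (auto simp: return_time_def split: if_splits)
  with L have n: "n = (LEAST n. 1 \<le> n \<and> (shift ^^ n) y \<in> J)"
    by (simp add: return_time_def)
  have "1 \<le> n \<and> (shift ^^ n) y \<in> J"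
    unfolding n using ex by (rule LeastI_ex)
  moreover have "\<forall>k. 1 \<le> k \<and> k < n \<longrightarrow> (shift ^^ k) y \<notin> J"
    using not_less_Least[of _ "\<lambda>n. 1 \<le> n \<and> (shift ^^ n) y \<in> J"] unfolding n[symmetric]
    by (metis (no_types))
  ultimately show ?R by blast
next
  assume R: ?R
  have L: "(LEAST n. 1 \<le> n \<and> (shift ^^ n) y \<in> J) = n"
  proof (rule Least_equality)
    fix m assume "1 \<le> m \<and> (shift ^^ m) y \<in> J"
    then show "n \<le> m" using R by (meson not_le_imp_less)
  qed (use R in blast)
  have "\<exists>n\<ge>1. (shift ^^ n) y \<in> J" using R by blast
  then show ?L unfolding return_time_def L by (rule if_P)
qed

lemma birkhoff_sum_prepend_cong:
  assumes "screened J g" "x \<in> J" "x' \<in> J" "length u = n"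
  shows "birkhoff_sum n g (prepend u x) = birkhoff_sum n g (prepend u x')"
  unfolding birkhoff_sum_def
proof (rule sum.cong)
  fix k assume "k \<in> {..<n}"
  then have "k \<le> length u" using assms(4) by simp
  then show "g ((shift ^^ k) (prepend u x)) = g ((shift ^^ k) (prepend u x'))"
    unfolding shift_funpow_prepend[OF \<open>k \<le> length u\<close>] by (intro screenedD[OF assms(1-3)])
qed simp

text \<open>Preimages of \<open>x\<close> and of \<open>x'\<close> are matched by prepending the same word; both the weights and the
condition to be a first return are screened.\<close>

lemma first_return_sum_const:
  fixes w :: "'a::finite list"
  assumes g: "screened (cylinder w) g" and x: "x \<in> cylinder w" and x': "x' \<in> cylinder w"
  shows "first_return_sum g (cylinder w) n x = first_return_sum g (cylinder w) n x'"
proof -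
  let ?J = "cylinder w"
  let ?A = "\<lambda>y. y \<in> ?J \<and> return_time ?J y = Some n"
  have words: "first_return_sum g ?J n z =
      (\<Sum>u\<in>words n. if ?A (prepend u z) then exp (birkhoff_sum n g (prepend u z)) else 0)" for z
  proof -
    have "first_return_sum g ?J n z =
        (\<Sum>y\<in>{y \<in> {y. (shift ^^ n) y = z}. ?A y}. exp (birkhoff_sum n g y))"
      unfolding first_return_sum_def by (rule sum.cong) auto
    also have "\<dots> = (\<Sum>y\<in>{y. (shift ^^ n) y = z}. if ?A y then exp (birkhoff_sum n g y) else 0)"
      by (rule sum.inter_filter) (rule finite_preimages)
    also have "\<dots> = (\<Sum>u\<in>words n. if ?A (prepend u z) then exp (birkhoff_sum n g (prepend u z)) else 0)"
      by (rule sum.reindex_bij_betw[OF bij_betw_prepend, symmetric])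
    finally show ?thesis .
  qed
  have J: "prepend v x \<in> ?J \<longleftrightarrow> prepend v x' \<in> ?J" for v
    using screenedD[OF screened_mem_cylinder x x'] by simp
  show ?thesis
    unfolding words
  proof (rule sum.cong)
    fix u :: "'a list" assume u: "u \<in> words n"
    have "(shift ^^ k) (prepend u x) \<in> ?J \<longleftrightarrow> (shift ^^ k) (prepend u x') \<in> ?J" if "k \<le> n" for k
      using that u J by (simp add: shift_funpow_prepend words_def)
    then have "?A (prepend u x) \<longleftrightarrow> ?A (prepend u x')"
      unfolding return_time_Some_iff using J by (meson less_imp_le order_refl)
    moreover have "birkhoff_sum n g (prepend u x) = birkhoff_sum n g (prepend u x')"
      using u by (intro birkhoff_sum_prepend_cong[OF g x x']) (simp add: words_def)
    ultimately show "(if ?A (prepend u x) then exp (birkhoff_sum n g (prepend u x)) else 0) =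
        (if ?A (prepend u x') then exp (birkhoff_sum n g (prepend u x')) else 0)"
      by simp
  qed simp
qed

lemma return_sum_0: "x \<in> J \<Longrightarrow> return_sum g J 0 x = 1"
proof -
  assume "x \<in> J"
  then have "{y \<in> J. (shift ^^ 0) y = x} = {x}" by auto
  then show ?thesis by (simp add: return_sum_def birkhoff_sum_def)
qed

lemma first_return_sum_nonneg: "0 \<le> first_return_sum g J n x"
  by (simp add: first_return_sum_def sum_nonneg)

lemma first_return_sum_0: "first_return_sum g J 0 x = 0"
  by (simp add: first_return_sum_def return_time_Some_iff)

text \<open>Each return to \<open>cylinder w\<close> is split at its first return time. The remaining piece starts at a
different point for each term, but the first return sum does not depend on this point, so the
decomposition is an honest renewal equation.\<close>

lemma return_sum_renewal:
  fixes w :: "'a::finite list"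
  assumes g: "screened (cylinder w) g" and x: "x \<in> cylinder w"
  shows "return_sum g (cylinder w) (Suc n) x =
    (\<Sum>k\<le>n. first_return_sum g (cylinder w) (Suc k) x * return_sum g (cylinder w) (n - k) x)"
proof -
  let ?J = "cylinder w"
  define S where "S = {y \<in> ?J. (shift ^^ Suc n) y = x}"
  define T where "T = Sigma {..n} (\<lambda>k. {y' \<in> ?J. (shift ^^ (n - k)) y' = x})"
  \<comment> \<open>A return is sent to its first return time, shifted down by one, and the point reached then.\<close>
  define r where "r y = (the (return_time ?J y) - 1, (shift ^^ the (return_time ?J y)) y)" for y
  have finS: "finite S"
    unfolding S_def by (rule finite_subset[OF _ finite_preimages[of "Suc n" x]]) auto
  have fin: "finite {y' \<in> ?J. (shift ^^ m) y' = x}" for m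
    by (rule finite_subset[OF _ finite_preimages[of m x]]) auto
  have finT: "finite T"
    unfolding T_def using fin by auto
  have ret: "\<exists>k\<le>n. return_time ?J y = Some (Suc k)" if "y \<in> S" for y
  proof -
    have "\<exists>m. 1 \<le> m \<and> (shift ^^ m) y \<in> ?J"
      using that x unfolding S_def by (intro exI[of _ "Suc n"]) auto
    then obtain m where m: "return_time ?J y = Some m"
      unfolding return_time_def by auto
    then have "1 \<le> m" by (simp add: return_time_Some_iff)
    moreover have "m \<le> Suc n"
    proof (rule ccontr)
      assume "\<not> m \<le> Suc n"
      then have "1 \<le> Suc n \<and> Suc n < m" by simp
      then have "(shift ^^ Suc n) y \<notin> ?J"
        using m unfolding return_time_Some_iff by blast
      then show False using that x by (simp add: S_def)
    qed
    ultimately show ?thesis using m by (intro exI[of _ "m - 1"]) auto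
  qed
  have split: "(shift ^^ Suc n) y = (shift ^^ (n - k)) ((shift ^^ Suc k) y)" if "k \<le> n" for y :: "'a seq" and k
    using that by (simp add: shift_funpow del: funpow.simps)
  have rT: "r ` S \<subseteq> T"
  proof
    fix p assume "p \<in> r ` S"
    then obtain y where y: "y \<in> S" "p = r y" by auto
    obtain k where k: "k \<le> n" "return_time ?J y = Some (Suc k)" using ret y by blast
    then have "(shift ^^ Suc k) y \<in> ?J" by (auto simp only: return_time_Some_iff)
    moreover have "(shift ^^ (n - k)) ((shift ^^ Suc k) y) = x"
      using y split[OF k(1)] unfolding S_def by simp
    ultimately show "p \<in> T"
      using k y by (simp add: T_def r_def del: funpow.simps)
  qed
  have fibre: "{y \<in> S. r y = (k, y')} =
      {y \<in> ?J. return_time ?J y = Some (Suc k) \<and> (shift ^^ Suc k) y = y'}"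
    if "(k, y') \<in> T" for k y'
  proof (intro equalityI subsetI)
    fix y assume "y \<in> {y \<in> S. r y = (k, y')}"
    then have y: "y \<in> S" "r y = (k, y')" by auto
    obtain l where l: "return_time ?J y = Some (Suc l)" using ret y by blast
    with y show "y \<in> {y \<in> ?J. return_time ?J y = Some (Suc k) \<and> (shift ^^ Suc k) y = y'}"
      by (auto simp add: r_def S_def simp del: funpow.simps)
  next
    fix y assume y: "y \<in> {y \<in> ?J. return_time ?J y = Some (Suc k) \<and> (shift ^^ Suc k) y = y'}"
    have "(shift ^^ Suc n) y = x"
      using that y split[of k y] by (auto simp add: T_def simp del: funpow.simps)
    with y show "y \<in> {y \<in> S. r y = (k, y')}"
      by (auto simp add: r_def S_def simp del: funpow.simps)
  qed
  have "return_sum g ?J (Suc n) x = (\<Sum>y\<in>S. exp (birkhoff_sum (Suc n) g y))"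
    by (simp only: return_sum_def S_def)
  also have "\<dots> = (\<Sum>p\<in>T. \<Sum>y\<in>{y \<in> S. r y = p}. exp (birkhoff_sum (Suc n) g y))"
    by (rule sum.group[OF finS finT rT, symmetric])
  also have "\<dots> = (\<Sum>(k, y')\<in>T. first_return_sum g ?J (Suc k) x * exp (birkhoff_sum (n - k) g y'))"
  proof (intro sum.cong refl, clarify)
    fix k y' assume p: "(k, y') \<in> T"
    then have k: "k \<le> n" and y': "y' \<in> ?J" by (auto simp: T_def)
    have "birkhoff_sum (Suc n) g y = birkhoff_sum (Suc k) g y + birkhoff_sum (n - k) g y'"
      if "(shift ^^ Suc k) y = y'" for y
      using birkhoff_sum_add[of "Suc k" "n - k" g y] that k by simp
    then have "(\<Sum>y\<in>{y \<in> S. r y = (k, y')}. exp (birkhoff_sum (Suc n) g y)) =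
        first_return_sum g ?J (Suc k) y' * exp (birkhoff_sum (n - k) g y')"
      unfolding fibre[OF p] first_return_sum_def sum_distrib_right
      by (intro sum.cong refl) (auto simp add: exp_add simp del: funpow.simps)
    then show "(\<Sum>y\<in>{y \<in> S. r y = (k, y')}. exp (birkhoff_sum (Suc n) g y)) =
        first_return_sum g ?J (Suc k) x * exp (birkhoff_sum (n - k) g y')"
      by (simp only: first_return_sum_const[OF g y' x])
  qed
  also have "\<dots> = (\<Sum>k\<le>n. first_return_sum g ?J (Suc k) x * return_sum g ?J (n - k) x)"
    unfolding T_def return_sum_def sum_distrib_left by (rule sum.Sigma[symmetric]) (use fin in auto)
  finally show ?thesis .
qed

text \<open>Arbitrary words are compared with returns: writing \<open>w\<close> in front of \<open>u @ v\<close> produces a point of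
\<open>cylinder w\<close>, at the cost of a factor for the \<open>length w + length v\<close> additional positions. The case
\<open>v = []\<close> bounds partition functions, and \<open>v\<close> the word of another cylinder transfers transience to
that cylinder.\<close>

lemma sum_prepend_le_return_sum:
  fixes w v :: "'a::finite list" and g :: "'a seq \<Rightarrow> real" and B :: real
  assumes g: "\<And>z. - B \<le> g z" and W: "W \<subseteq> words n"
  shows "(\<Sum>u\<in>W. exp (birkhoff_sum n g (prepend (u @ v) x)))
    \<le> exp ((length w + length v) * B) * return_sum g (cylinder w) (length w + n + length v) x"
proof -
  let ?N = "length w + n + length v"
  let ?R = "{y \<in> cylinder w. (shift ^^ ?N) y = x}"
  have low: "- (real m * B) \<le> birkhoff_sum m g z" for m z
    using sum_mono[of "{..<m}" "\<lambda>_. - B" "\<lambda>k. g ((shift ^^ k) z)"] g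
    by (simp add: birkhoff_sum_def)
  have each: "exp (birkhoff_sum n g (prepend (u @ v) x))
      \<le> exp ((length w + length v) * B) * exp (birkhoff_sum ?N g (prepend (w @ u @ v) x))"
    if "u \<in> W" for u
  proof -
    have u: "length u = n" using that W by (auto simp: words_def)
    have "birkhoff_sum ?N g (prepend (w @ u @ v) x) =
        birkhoff_sum (length w) g (prepend (w @ u @ v) x) +
        (birkhoff_sum n g (prepend (u @ v) x) + birkhoff_sum (length v) g (prepend v x))"
      using u by (simp add: birkhoff_sum_add add.assoc shift_funpow_prepend)
    then have "birkhoff_sum n g (prepend (u @ v) x)
        \<le> (length w + length v) * B + birkhoff_sum ?N g (prepend (w @ u @ v) x)"
      using low[of "length w" "prepend (w @ u @ v) x"] low[of "length v" "prepend v x"]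
      by (simp add: algebra_simps)
    then show ?thesis by (simp add: exp_add[symmetric])
  qed
  have "(\<Sum>u\<in>W. exp (birkhoff_sum ?N g (prepend (w @ u @ v) x))) =
      (\<Sum>y\<in>(\<lambda>u. prepend (w @ u @ v) x) ` W. exp (birkhoff_sum ?N g y))"
  proof (rule sum.reindex_cong[symmetric, OF _ refl refl])
    show "inj_on (\<lambda>u. prepend (w @ u @ v) x) W"
    proof (rule inj_onI)
      fix u u' assume "u \<in> W" "u' \<in> W" and eq: "prepend (w @ u @ v) x = prepend (w @ u' @ v) x"
      then have "length (w @ u @ v) = ?N" "length (w @ u' @ v) = ?N"
        using W by (auto simp: words_def)
      then have "w @ u @ v = w @ u' @ v"
        using eq by (metis initial_prepend)
      then show "u = u'" by simp
    qed
  qed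
  also have "\<dots> \<le> return_sum g (cylinder w) ?N x"
    unfolding return_sum_def
  proof (rule sum_mono2)
    show "finite ?R"
      by (rule finite_subset[OF _ finite_preimages[of ?N x]]) auto
    show "(\<lambda>u. prepend (w @ u @ v) x) ` W \<subseteq> ?R"
    proof clarify
      fix u assume "u \<in> W"
      then have "length (w @ u @ v) = ?N" using W by (auto simp: words_def)
      then have "(shift ^^ ?N) (prepend (w @ u @ v) x) = x"
        using shift_prepend_length by metis
      then show "prepend (w @ u @ v) x \<in> cylinder w \<and> (shift ^^ ?N) (prepend (w @ u @ v) x) = x"
        by (simp only: prepend_append[of w] prepend_in_cylinder)
    qed
  qed simp
  finally have "(\<Sum>u\<in>W. exp (birkhoff_sum ?N g (prepend (w @ u @ v) x)))
      \<le> return_sum g (cylinder w) ?N x" .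
  moreover have "(\<Sum>u\<in>W. exp (birkhoff_sum n g (prepend (u @ v) x)))
      \<le> exp ((length w + length v) * B) *
        (\<Sum>u\<in>W. exp (birkhoff_sum ?N g (prepend (w @ u @ v) x)))"
    unfolding sum_distrib_left by (rule sum_mono) (rule each)
  ultimately show ?thesis
    by (meson exp_ge_zero mult_left_mono order_trans)
qed

lemma induced_transfer_eq:
  "induced_transfer J 0 \<beta> V (indicator J) x =
     (\<Sum>n. ennreal (first_return_sum (\<lambda>y. \<beta> * V y) J n x))"
  unfolding induced_transfer_def first_return_sum_def
proof (intro suminf_cong)
  fix n
  let ?S = "{y \<in> J. return_time J y = Some n \<and> (shift ^^ n) y = x}"
  have "(\<Sum>y\<in>?S. ennreal (exp (\<beta> * birkhoff_sum n V y - real n * 0)) * indicator J y) =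
      (\<Sum>y\<in>?S. ennreal (exp (birkhoff_sum n (\<lambda>y. \<beta> * V y) y)))"
    by (rule sum.cong) (simp_all add: birkhoff_sum_def sum_distrib_left)
  also have "\<dots> = ennreal (\<Sum>y\<in>?S. exp (birkhoff_sum n (\<lambda>y. \<beta> * V y) y))"
    by (rule sum_ennreal) simp
  finally show "(\<Sum>y\<in>?S. ennreal (exp (\<beta> * birkhoff_sum n V y - real n * 0)) * indicator J y) =
      ennreal (\<Sum>y\<in>?S. exp (birkhoff_sum n (\<lambda>y. \<beta> * V y) y))" .
qed

lemma suminf_ennreal_less_1_iff:
  fixes f :: "nat \<Rightarrow> real"
  assumes f: "\<And>n. 0 \<le> f n"
  shows "(\<Sum>n. ennreal (f n)) < 1 \<longleftrightarrow> (\<exists>q<1. \<forall>n. (\<Sum>k<n. f k) \<le> q)"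
proof
  assume less: "(\<Sum>n. ennreal (f n)) < 1"
  then have fin: "(\<Sum>n. ennreal (f n)) < top"
    using ennreal_one_less_top less_trans by blast
  let ?q = "enn2real (\<Sum>n. ennreal (f n))"
  have "ennreal ?q < 1" using less fin by simp
  then have "?q < 1" by (simp add: ennreal_less_one_iff)
  moreover have "(\<Sum>k<n. f k) \<le> ?q" for n
  proof -
    have "(\<Sum>k<n. ennreal (f k)) \<le> (\<Sum>n. ennreal (f n))"
      by (rule sum_le_suminf) auto
    then have "ennreal (\<Sum>k<n. f k) \<le> (\<Sum>n. ennreal (f n))"
      by (simp only: sum_ennreal[OF f])
    then have "enn2real (ennreal (\<Sum>k<n. f k)) \<le> ?q"
      using fin by (intro enn2real_mono) auto
    then show ?thesis using f by (simp add: sum_nonneg)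
  qed
  ultimately show "\<exists>q<1. \<forall>n. (\<Sum>k<n. f k) \<le> q" by blast
next
  assume "\<exists>q<1. \<forall>n. (\<Sum>k<n. f k) \<le> q"
  then obtain q where q: "q < 1" "\<And>n. (\<Sum>k<n. f k) \<le> q" by blast
  have "(\<Sum>n. ennreal (f n)) \<le> ennreal q"
    unfolding suminf_eq_SUP
  proof (rule SUP_least)
    fix n show "(\<Sum>k<n. ennreal (f k)) \<le> ennreal q"
      unfolding sum_ennreal[OF f] by (rule ennreal_leI) (rule q)
  qed
  also have "\<dots> < 1"
    using q by (simp add: ennreal_less_one_iff)
  finally show "(\<Sum>n. ennreal (f n)) < 1" .
qed

lemma induced_transfer_less_1_iff:
  "induced_transfer J 0 \<beta> V (indicator J) x < 1 \<longleftrightarrow>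
    (\<exists>q<1. \<forall>n. (\<Sum>k<n. first_return_sum (\<lambda>y. \<beta> * V y) J (Suc k) x) \<le> q)"
proof -
  let ?f = "\<lambda>n. first_return_sum (\<lambda>y. \<beta> * V y) J n x"
  have eq: "(\<Sum>k<Suc n. ?f k) = (\<Sum>k<n. ?f (Suc k))" for n
    by (simp add: sum.lessThan_Suc_shift first_return_sum_0 del: sum.lessThan_Suc)
  have "(\<forall>n. (\<Sum>k<n. ?f k) \<le> q) \<longleftrightarrow> (\<forall>n. (\<Sum>k<n. ?f (Suc k)) \<le> q)" for q
  proof
    assume *: "\<forall>n. (\<Sum>k<n. ?f k) \<le> q"
    show "\<forall>n. (\<Sum>k<n. ?f (Suc k)) \<le> q"
      using * unfolding eq[symmetric] by blast
  next
    assume *: "\<forall>n. (\<Sum>k<n. ?f (Suc k)) \<le> q"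
    show "\<forall>n. (\<Sum>k<n. ?f k) \<le> q"
    proof
      fix n
      have "(\<Sum>k<n. ?f k) \<le> (\<Sum>k<Suc n. ?f k)"
        by (simp add: first_return_sum_nonneg)
      also have "\<dots> \<le> q" unfolding eq using * by blast
      finally show "(\<Sum>k<n. ?f k) \<le> q" .
    qed
  qed
  then show ?thesis
    unfolding induced_transfer_eq suminf_ennreal_less_1_iff[OF first_return_sum_nonneg] by simp
qed

text \<open>The sum of all return sums is finite for one screening cylinder if and only if it is finite for any
other one, since a return to \<open>cylinder w'\<close> becomes a return to \<open>cylinder w\<close> when it is placed between
\<open>w\<close> and a point of \<open>cylinder w\<close>. By the renewal equation, finiteness means that the first return
sums add up to less than one.\<close>

lemma induced_transfer_less_1_other_cylinder:
  fixes w w' :: "'a::finite list" and V :: "'a seq \<Rightarrow> real"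
  assumes V: "\<And>z. - B \<le> \<beta> * V z"
    and scr: "screened (cylinder w) V" "screened (cylinder w') V"
    and x: "x \<in> cylinder w" and x': "x' \<in> cylinder w'"
    and less: "induced_transfer (cylinder w) 0 \<beta> V (indicator (cylinder w)) x < 1"
  shows "induced_transfer (cylinder w') 0 \<beta> V (indicator (cylinder w')) x' < 1"
proof -
  define g where "g = (\<lambda>y. \<beta> * V y)"
  have g: "screened (cylinder w) g" "screened (cylinder w') g"
    using scr unfolding screened_def g_def by metis+
  obtain q where q: "q < 1" "\<And>n. (\<Sum>k<n. first_return_sum g (cylinder w) (Suc k) x) \<le> q"
    using less unfolding induced_transfer_less_1_iff g_def by blast
  have summ: "summable (\<lambda>n. return_sum g (cylinder w) n x)"
    by (rule renewal_transient[OF return_sum_0[OF x] return_sum_renewal[OF g(1) x]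
          first_return_sum_nonneg q(2,1)])
  define z where "z = prepend w' x"
  have z: "z \<in> cylinder w'" by (simp add: z_def)
  define C where "C = exp ((length w + length w') * B)"
  have bound: "return_sum g (cylinder w') n z
      \<le> C * return_sum g (cylinder w) (n + (length w + length w')) x" for n
  proof -
    define W where "W = {u \<in> words n. prepend u z \<in> cylinder w'}"
    have "return_sum g (cylinder w') n z = (\<Sum>u\<in>W. exp (birkhoff_sum n g (prepend u z)))"
      unfolding return_sum_def
    proof (rule sum.reindex_bij_betw[symmetric, OF bij_betw_subset[OF bij_betw_prepend]])
      show "W \<subseteq> words n" by (auto simp: W_def)
      have "(\<lambda>u. prepend u z) ` W = cylinder w' \<inter> (\<lambda>u. prepend u z) ` words n"
        unfolding W_def by auto
      also have "(\<lambda>u. prepend u z) ` words n = {y. (shift ^^ n) y = z}"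
        by (rule bij_betw_imp_surj_on[OF bij_betw_prepend])
      finally show "(\<lambda>u. prepend u z) ` W = {y \<in> cylinder w'. (shift ^^ n) y = z}"
        by auto
    qed
    also have "\<dots> = (\<Sum>u\<in>W. exp (birkhoff_sum n g (prepend (u @ w') x)))"
      by (simp add: prepend_append z_def)
    also have "\<dots> \<le> C * return_sum g (cylinder w) (length w + n + length w') x"
      unfolding C_def using V by (intro sum_prepend_le_return_sum) (auto simp: g_def W_def)
    finally show ?thesis by (simp add: add_ac)
  qed
  have "summable (\<lambda>n. return_sum g (cylinder w') n z)"
  proof (rule summable_comparison_test)
    show "summable (\<lambda>n. C * return_sum g (cylinder w) (n + (length w + length w')) x)"
      by (intro summable_mult summable_ignore_initial_segment summ)
    show "\<exists>N. \<forall>n\<ge>N. norm (return_sum g (cylinder w') n z)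
        \<le> C * return_sum g (cylinder w) (n + (length w + length w')) x"
      using bound by (auto simp: return_sum_def sum_nonneg)
  qed
  from renewal_transient_converse[OF return_sum_0[OF z] return_sum_renewal[OF g(2) z]
      first_return_sum_nonneg this]
  have "\<exists>q<1. \<forall>n. (\<Sum>k<n. first_return_sum g (cylinder w') (Suc k) z) \<le> q"
    by metis
  then show ?thesis
    unfolding induced_transfer_less_1_iff g_def[symmetric] first_return_sum_const[OF g(2) x' z] .
qed

section \<open>Topology and measurable structure of the shift space\<close>

lemma initial_mono: "initial n x = initial n y \<Longrightarrow> m \<le> n \<Longrightarrow> initial m x = initial m y"
  unfolding initial_eq_iff by auto

lemma initial_eq_if_seq_dist_less:
  assumes "seq_dist x y < (1/2) ^ n"
  shows "initial (Suc n) x = initial (Suc n) y"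
proof (cases "x = y")
  case False
  define l where "l = (LEAST i. x i \<noteq> y i)"
  have "(1/2 :: real) ^ l < (1/2) ^ n"
    using assms False by (simp add: seq_dist_def l_def)
  then have "n < l"
    by (simp add: power_strict_decreasing_iff)
  moreover have "x i = y i" if "i < l" for i
    using not_less_Least[of i "\<lambda>i. x i \<noteq> y i"] that by (simp add: l_def)
  ultimately show ?thesis
    unfolding initial_eq_iff by simp
qed simp

lemma seq_dist_le_if_initial_eq:
  assumes "initial n x = initial n y"
  shows "seq_dist x y \<le> (1/2) ^ n"
proof (cases "x = y")
  case False
  then obtain i where "x i \<noteq> y i" by (auto simp: fun_eq_iff)
  then have "x (LEAST i. x i \<noteq> y i) \<noteq> y (LEAST i. x i \<noteq> y i)"
    by (rule LeastI)
  then have "n \<le> (LEAST i. x i \<noteq> y i)"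
    using assms unfolding initial_eq_iff by (meson not_le_imp_less)
  then show ?thesis
    using False by (simp add: seq_dist_def power_decreasing)
qed (simp add: seq_dist_def)

lemma openin_seq_topology_iff:
  "openin seq_topology U \<longleftrightarrow> (\<forall>x\<in>U. \<exists>n. \<forall>y. initial n y = initial n x \<longrightarrow> y \<in> U)"
proof -
  interpret Metric_space UNIV seq_dist by (rule Metric_space_seq_dist)
  have "(\<exists>r>0. mball x r \<subseteq> U) \<longleftrightarrow> (\<exists>n. \<forall>y. initial n y = initial n x \<longrightarrow> y \<in> U)" for x
  proof
    assume "\<exists>r>0. mball x r \<subseteq> U"
    then obtain r where r: "0 < r" "mball x r \<subseteq> U" by blast
    obtain n where n: "(1/2) ^ n < r"
      using real_arch_pow_inv[OF r(1), of "1/2"] by auto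
    have "y \<in> U" if "initial n y = initial n x" for y
    proof -
      have "seq_dist x y < r"
        using seq_dist_le_if_initial_eq[OF that[symmetric]] n by simp
      then show ?thesis using r(2) by auto
    qed
    then show "\<exists>n. \<forall>y. initial n y = initial n x \<longrightarrow> y \<in> U" by blast
  next
    assume "\<exists>n. \<forall>y. initial n y = initial n x \<longrightarrow> y \<in> U"
    then obtain n where n: "\<And>y. initial n y = initial n x \<Longrightarrow> y \<in> U" by blast
    have "mball x ((1/2) ^ n) \<subseteq> U"
    proof
      fix y assume "y \<in> mball x ((1/2) ^ n)"
      then have "initial (Suc n) x = initial (Suc n) y"
        by (intro initial_eq_if_seq_dist_less) simp
      then have "initial n x = initial n y"
        by (rule initial_mono) simp
      then show "y \<in> U" using n by metis
    qed
    then show "\<exists>r>0. mball x r \<subseteq> U"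
      by (intro exI[of _ "(1/2) ^ n"]) simp
  qed
  then show ?thesis
    unfolding seq_topology_def openin_mtopology by (simp add: Ball_def)
qed

lemma openin_cylinder: "openin seq_topology (cylinder w)"
  unfolding openin_seq_topology_iff
  by (intro ballI exI[of _ "length w"]) (simp add: mem_cylinder_iff)

lemma open_eq_Union_cylinders:
  assumes "openin seq_topology U"
  shows "U = \<Union> {cylinder w | w. cylinder w \<subseteq> U}"
proof (rule equalityI)
  show "U \<subseteq> \<Union> {cylinder w | w. cylinder w \<subseteq> U}"
  proof
    fix x assume "x \<in> U"
    then obtain n where "\<And>y. initial n y = initial n x \<Longrightarrow> y \<in> U"
      using assms unfolding openin_seq_topology_iff by blast
    then have "cylinder (initial n x) \<subseteq> U" "x \<in> cylinder (initial n x)"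
      by (auto simp: mem_cylinder_iff)
    then show "x \<in> \<Union> {cylinder w | w. cylinder w \<subseteq> U}" by blast
  qed
qed blast

lemma space_seq_borel [simp]: "space seq_borel = UNIV"
  by (simp add: seq_borel_def)

lemma countable_cylinders: "countable (range (cylinder :: 'a::finite list \<Rightarrow> _))"
  using countable_lists[OF countable_finite[OF finite[of "UNIV :: 'a set"]]] by simp

lemma sets_seq_borel: "sets (seq_borel :: 'a::finite seq measure) = sigma_sets UNIV (range cylinder)"
proof -
  have "sigma_sets UNIV {U. openin seq_topology U} = sigma_sets UNIV (range (cylinder :: 'a list \<Rightarrow> _))"
  proof (rule sigma_sets_eqI)
    fix U :: "'a seq set" assume "U \<in> {U. openin seq_topology U}"
    then have U: "U = \<Union> {cylinder w | w. cylinder w \<subseteq> U}"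
      by (intro open_eq_Union_cylinders) simp
    have "\<Union> {cylinder w | w. cylinder w \<subseteq> U} \<in> sigma_sets UNIV (range cylinder)"
    proof (rule sigma_sets_UNION)
      show "countable {cylinder w | w. cylinder w \<subseteq> U}"
        by (rule countable_subset[OF _ countable_cylinders]) blast
    qed (auto intro: sigma_sets.Basic)
    then show "U \<in> sigma_sets UNIV (range cylinder)" using U by simp
  next
    fix C :: "'a seq set" assume "C \<in> range cylinder"
    then show "C \<in> sigma_sets UNIV {U. openin seq_topology U}"
      by (auto intro: sigma_sets.Basic openin_cylinder)
  qed
  then show ?thesis by (simp add: seq_borel_def)
qed

lemma cylinder_in_sets [measurable]: "cylinder (w :: 'a::finite list) \<in> sets seq_borel"
  unfolding sets_seq_borel by (rule sigma_sets.Basic) simp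

lemma measurable_initial [measurable]:
  "initial n \<in> measurable (seq_borel :: 'a::finite seq measure) (count_space UNIV)"
proof -
  have c: "countable (UNIV :: 'a list set)"
    using countable_lists[OF countable_finite[OF finite[of "UNIV :: 'a set"]]] by simp
  have "initial n -` {u} \<in> sets (seq_borel :: 'a seq measure)" for u
  proof (cases "length u = n")
    case True
    then have "initial n -` {u} = cylinder u" by (auto simp: mem_cylinder_iff)
    then show ?thesis by simp
  next
    case False
    then have "initial n -` {u} = {}" by auto
    then show ?thesis by simp
  qed
  then show ?thesis
    unfolding measurable_count_space_eq_countable[OF c] by simp
qed

lemma initial_shift_eq_tl: "initial n (shift x) = tl (initial (Suc n) x)"
  by (rule nth_equalityI) (simp_all add: initial_def shift_def nth_tl del: upt_Suc)

lemma measurable_shift [measurable]: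
  "shift \<in> measurable (seq_borel :: 'a::finite seq measure) seq_borel"
proof (rule measurable_sigma_sets[OF sets_seq_borel])
  fix C :: "'a seq set" assume "C \<in> range cylinder"
  then obtain w where w: "C = cylinder w" by blast
  have "shift -` cylinder w = initial (Suc (length w)) -` {u. tl u = w}"
    by (auto simp: mem_cylinder_iff initial_shift_eq_tl)
  moreover have "initial (Suc (length w)) -` {u. tl u = w} \<in> sets (seq_borel :: 'a seq measure)"
    using measurable_sets[OF measurable_initial[of "Suc (length w)"], of "{u. tl u = w}"] by simp
  ultimately show "shift -` C \<inter> space seq_borel \<in> sets seq_borel"
    by (simp add: w)
qed auto

lemma measurable_if_initial:
  fixes f :: "'a::finite seq \<Rightarrow> 'b"
  assumes "\<And>x y. initial n x = initial n y \<Longrightarrow> f x = f y"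
  shows "f \<in> measurable seq_borel (count_space UNIV)"
proof -
  have "f = (\<lambda>u. f (prepend u undefined)) \<circ> initial n"
    by (rule ext) (auto intro!: assms)
  also have "\<dots> \<in> measurable seq_borel (count_space UNIV)"
    by (rule measurable_comp[OF measurable_initial]) simp
  finally show ?thesis .
qed

text \<open>The sets that depend on finitely many coordinates form an algebra that generates the Borel sets, so
they are dense in the measure algebra; the sets that can be approximated form a \<open>\<sigma>\<close>-algebra.\<close>

lemma approx_by_words:
  fixes M :: "'a::finite seq measure"
  assumes "prob_space M" and sets_M: "sets M = sets seq_borel" and A: "A \<in> sets M" and "0 < e"
  obtains n S where "measure M (sym_diff A (initial n -` S)) \<le> e"
proof -
  interpret prob_space M by fact
  have meas [measurable]: "initial n -` S \<in> sets M" for n and S :: "'a list set"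
    using measurable_sets[OF measurable_initial[of n], of S] by (simp add: sets_M)
  have space_M: "space M = UNIV"
    using sets_eq_imp_space_eq[OF sets_M] by simp
  have "A \<in> sigma_sets UNIV (range cylinder)" using A by (simp add: sets_M sets_seq_borel)
  then have "\<forall>e>0. \<exists>n S. measure M (sym_diff A (initial n -` S)) \<le> e"
  proof (induction rule: sigma_sets.induct)
    case (Basic A)
    then obtain w where "A = cylinder w" by blast
    then have "A = initial (length w) -` {w}" by (auto simp: mem_cylinder_iff)
    then have "measure M (sym_diff A (initial (length w) -` {w})) = 0" by simp
    then show ?case by (metis less_imp_le)
  next
    case Empty
    have "measure M (sym_diff {} (initial 0 -` {})) = 0" by simp
    then show ?case by (metis less_imp_le)
  next
    case (Compl A)
    have "sym_diff (UNIV - A) (initial n -` (- S)) = sym_diff A (initial n -` S)" for n and S :: "'a list set"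
      by auto
    then show ?case using Compl.IH by metis
  next
    case (Union A)
    show ?case
    proof (intro allI impI)
      fix e :: real assume e: "0 < e"
      have A: "A i \<in> sets M" for i
        using Union.hyps by (simp add: sets_M sets_seq_borel)
      have "(\<lambda>N. measure M (\<Union>i<N. A i)) \<longlonglongrightarrow> measure M (\<Union>N. \<Union>i<N. A i)"
        using A by (intro finite_Lim_measure_incseq) (auto simp: incseq_def, force)
      moreover have UN: "(\<Union>N. \<Union>i<N. A i) = (\<Union>i. A i)" by blast
      ultimately obtain N where N: "\<bar>measure M (\<Union>i<N. A i) - measure M (\<Union>i. A i)\<bar> < e / 2"
        using e unfolding LIMSEQ_iff by (metis half_gt_zero order_refl real_norm_def)
      \<comment> \<open>The finitely many pieces share the second half of the error budget; the first half pays for the cut at \<open>N\<close>.\<close>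
      define d where "d = e / (2 * (real N + 1))"
      have "0 < d" using e by (simp add: d_def)
      then have "\<forall>i. \<exists>n S. measure M (sym_diff (A i) (initial n -` S)) \<le> d"
        using Union.IH by blast
      then obtain n S where nS: "\<And>i. measure M (sym_diff (A i) (initial (n i) -` S i)) \<le> d"
        by metis
      define m where "m = Max (n ` {..N})"
      have m: "n i \<le> m" if "i < N" for i
        using that by (simp add: m_def)
      define T where "T = {u. \<exists>i<N. take (n i) u \<in> S i}"
      have take: "take (n i) (initial m x) = initial (n i) x" if "i < N" for i and x :: "'a seq"
        using initial_shift[of 0 "n i" m x] m[OF that] by simp
      have T: "initial m -` T = (\<Union>i<N. initial (n i) -` S i)"
        using take by (auto simp: T_def)
      let ?R = "(\<Union>i. A i) - (\<Union>i<N. A i)"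
      let ?D = "\<Union>i<N. sym_diff (A i) (initial (n i) -` S i)"
      have "measure M (sym_diff (\<Union>i. A i) (initial m -` T)) \<le> measure M (?R \<union> ?D)"
      proof (rule finite_measure_mono)
        show "sym_diff (\<Union>i. A i) (initial m -` T) \<subseteq> ?R \<union> ?D" unfolding T by blast
        show "?R \<union> ?D \<in> sets M" using A by measurable
      qed
      also have "\<dots> \<le> measure M ?R + measure M ?D"
        using A by (intro measure_Un_le) auto
      also have "measure M ?R = measure M (\<Union>i. A i) - measure M (\<Union>i<N. A i)"
        using A by (intro finite_measure_Diff) auto
      also have "measure M ?D \<le> (\<Sum>i<N. measure M (sym_diff (A i) (initial (n i) -` S i)))"
        using A by (intro finite_measure_subadditive_finite) auto
      also have "\<dots> \<le> (\<Sum>i<N. d)" by (intro sum_mono nS)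
      also have "\<dots> \<le> e / 2" using e by (simp add: d_def field_simps)
      also have "measure M (\<Union>i. A i) - measure M (\<Union>i<N. A i) + e / 2 \<le> e" using N by linarith
      finally have "measure M (sym_diff (\<Union>i. A i) (initial m -` T)) \<le> e" by simp
      then show "\<exists>n S. measure M (sym_diff (\<Union> (range A)) (initial n -` S)) \<le> e" by blast
    qed
  qed
  then show ?thesis using that \<open>0 < e\<close> by blast
qed

section \<open>The potential along orbits that follow the subshift\<close>

lemma factor_mono:
  assumes "initial n x \<in> initial n ` K" "m \<le> n"
  shows "initial m x \<in> initial m ` K"
proof -
  obtain y where "y \<in> K" "initial n x = initial n y" using assms(1) by blast
  then show ?thesis using initial_mono[OF _ assms(2), of x y] by blast
qed

lemma openin_Compl_subshift: "subshift K \<Longrightarrow> openin seq_topology (- K)"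
proof -
  assume K: "subshift K"
  have "topspace (seq_topology :: 'a seq topology) = UNIV"
    unfolding seq_topology_def by (simp add: Metric_space.topspace_mtopology[OF Metric_space_seq_dist])
  then show ?thesis
    using K by (simp add: subshift_def closedin_def Compl_eq_Diff_UNIV)
qed

lemma subshift_ex_not_factor:
  assumes "subshift K" "x \<notin> K"
  shows "\<exists>n. initial n x \<notin> initial n ` K"
proof (rule ccontr)
  assume "\<not> ?thesis"
  then have *: "\<exists>y\<in>K. initial n y = initial n x" for n by (metis image_iff)
  have "openin seq_topology (- K)" by (rule openin_Compl_subshift[OF assms(1)])
  then obtain n where "\<And>y. initial n y = initial n x \<Longrightarrow> y \<notin> K"
    using assms(2) unfolding openin_seq_topology_iff by blast
  with * show False by blast
qed

lemma phi_eq_at_exit: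
  assumes "K \<noteq> {}" and n: "initial n x \<in> initial n ` K" "initial (Suc n) x \<notin> initial (Suc n) ` K"
  shows "\<phi>\<^sub>0 K x = ln (1 + 1 / (real n + 1))"
proof -
  have "dist_to x K = (1/2) ^ n"
    unfolding dist_to_def
  proof (rule antisym)
    obtain y where y: "y \<in> K" "initial n x = initial n y" using n(1) by blast
    have "(INF y\<in>K. seq_dist x y) \<le> seq_dist x y"
      by (rule cINF_lower[OF _ y(1)]) (auto simp: bdd_below_def seq_dist_def intro!: exI[of _ 0])
    also have "\<dots> \<le> (1/2) ^ n" by (rule seq_dist_le_if_initial_eq) (rule y)
    finally show "(INF y\<in>K. seq_dist x y) \<le> (1/2) ^ n" .
    show "(1/2) ^ n \<le> (INF y\<in>K. seq_dist x y)"
    proof (rule cINF_greatest[OF assms(1)])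
      fix y assume "y \<in> K"
      then show "(1/2) ^ n \<le> seq_dist x y"
        using n(2) initial_eq_if_seq_dist_less by (metis imageI not_le)
    qed
  qed
  moreover have "(THE k. (1/2 :: real) ^ n = (1/2) ^ k) = n"
    by (rule the_equality) (auto simp: power_one_over)
  moreover have "x \<notin> K" using n(2) by blast
  ultimately show ?thesis by (simp add: \<phi>\<^sub>0_def)
qed

text \<open>The number \<open>n\<close> is the length of the longest prefix of \<open>x\<close> that occurs in \<open>K\<close>.\<close>

lemma exit_level:
  assumes "K \<noteq> {}" "initial N x \<notin> initial N ` K"
  obtains n where "n < N" "initial n x \<in> initial n ` K" "initial (Suc n) x \<notin> initial (Suc n) ` K"
proof -
  define k where "k = (LEAST k. initial k x \<notin> initial k ` K)"
  have k: "initial k x \<notin> initial k ` K" unfolding k_def by (rule LeastI) (rule assms(2))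
  have "k \<le> N" unfolding k_def by (rule Least_le) (rule assms(2))
  have "k \<noteq> 0"
  proof
    assume "k = 0"
    then show False using k assms(1) by (auto simp: initial_def)
  qed
  then obtain n where n: "k = Suc n" by (cases k) auto
  have "n < (LEAST k. initial k x \<notin> initial k ` K)"
    unfolding k_def[symmetric] n by simp
  then have "initial n x \<in> initial n ` K"
    by (blast dest: not_less_Least)
  then show ?thesis using that[of n] k n \<open>k \<le> N\<close> by simp
qed

lemma phi_cases:
  assumes "subshift K"
  obtains "x \<in> K" "\<phi>\<^sub>0 K x = 0"
  | n where "initial n x \<in> initial n ` K" "initial (Suc n) x \<notin> initial (Suc n) ` K"
      "\<phi>\<^sub>0 K x = ln (1 + 1 / (real n + 1))"
proof (cases "x \<in> K")
  case True
  then show ?thesis using that(1) by (simp add: \<phi>\<^sub>0_def)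
next
  case False
  have "K \<noteq> {}" using assms by (simp add: subshift_def)
  obtain N where N: "initial N x \<notin> initial N ` K"
    using subshift_ex_not_factor[OF assms False] by blast
  obtain n where n: "initial n x \<in> initial n ` K" "initial (Suc n) x \<notin> initial (Suc n) ` K"
    by (rule exit_level[OF \<open>K \<noteq> {}\<close> N])
  show ?thesis by (rule that(2)[OF n phi_eq_at_exit[OF \<open>K \<noteq> {}\<close> n]])
qed

lemma phi_nonneg: "subshift K \<Longrightarrow> 0 \<le> \<phi>\<^sub>0 K x"
  by (erule phi_cases[of K x]) auto

lemma phi_le_if_factor:
  assumes "subshift K" "initial n x \<in> initial n ` K"
  shows "\<phi>\<^sub>0 K x \<le> ln (1 + 1 / (real n + 1))"
proof (cases rule: phi_cases[OF assms(1), of x])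
  case (2 m)
  then have "n \<le> m"
    using factor_mono[OF assms(2), of "Suc m"] by (meson not_less_eq_eq)
  then show ?thesis
    unfolding 2(3) by (simp add: field_simps frac_le)
qed simp

lemma phi_le_ln2: "subshift K \<Longrightarrow> \<phi>\<^sub>0 K x \<le> ln 2"
  using phi_le_if_factor[of K 0 x] by (auto simp: initial_def subshift_def)

text \<open>Once a prefix of \<open>x\<close> does not occur in \<open>K\<close>, the letters behind that prefix are irrelevant.\<close>

lemma phi_cong:
  assumes "subshift K" "initial n x \<notin> initial n ` K" "initial n x = initial n y"
  shows "\<phi>\<^sub>0 K x = \<phi>\<^sub>0 K y"
proof -
  have K: "K \<noteq> {}" using assms(1) by (simp add: subshift_def)
  obtain l where l: "l < n" "initial l x \<in> initial l ` K" "initial (Suc l) x \<notin> initial (Suc l) ` K"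
    by (rule exit_level[OF K assms(2)])
  have "initial l x = initial l y" "initial (Suc l) x = initial (Suc l) y"
    using l(1) by (auto intro: initial_mono[OF assms(3)])
  then have "initial l y \<in> initial l ` K" "initial (Suc l) y \<notin> initial (Suc l) ` K"
    using l by simp_all
  then have "\<phi>\<^sub>0 K y = ln (1 + 1 / (real l + 1))" by (rule phi_eq_at_exit[OF K])
  moreover have "\<phi>\<^sub>0 K x = ln (1 + 1 / (real l + 1))" by (rule phi_eq_at_exit[OF K l(2,3)])
  ultimately show ?thesis by simp
qed

text \<open>Either the common prefix of length \<open>n\<close> does not occur in \<open>K\<close> and both values agree, or \<open>y\<close> is so
close to \<open>K\<close> that its value is already small.\<close>

lemma phi_shadow:
  assumes "subshift K" "initial n x = initial n y"
  shows "\<phi>\<^sub>0 K y \<le> \<phi>\<^sub>0 K x + ln (1 + 1 / (real n + 1))"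
proof (cases "initial n y \<in> initial n ` K")
  case True
  then show ?thesis using phi_le_if_factor[OF assms(1)] phi_nonneg[OF assms(1), of x] by fastforce
next
  case False
  then have "\<phi>\<^sub>0 K y = \<phi>\<^sub>0 K x"
    by (rule phi_cong[OF assms(1)]) (rule assms(2)[symmetric])
  then show ?thesis by simp
qed

lemma sum_ln_telescope: "(\<Sum>k<n. ln (1 + 1 / (real (n - k) + 1))) = ln ((real n + 2) / 2)"
proof -
  have "(\<Sum>k<n. ln (1 + 1 / (real (n - k) + 1))) = (\<Sum>k<n. ln (1 + 1 / (real (Suc (n - Suc k)) + 1)))"
    by (intro sum.cong refl) (simp add: Suc_diff_Suc)
  also have "\<dots> = (\<Sum>k<n. ln (1 + 1 / (real (Suc k) + 1)))"
    by (rule sum.nat_diff_reindex)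
  also have "\<dots> = ln ((real n + 2) / 2)"
  proof (induction n)
    case (Suc n)
    have "(real n + 2) / 2 * (1 + 1 / (real (Suc n) + 1)) = (real (Suc n) + 2) / 2"
      by (simp add: field_simps)
    moreover have "ln ((real n + 2) / 2 * (1 + 1 / (real (Suc n) + 1))) =
        ln ((real n + 2) / 2) + ln (1 + 1 / (real (Suc n) + 1))"
      by (rule ln_mult_pos) (auto intro: add_pos_nonneg)
    ultimately show ?case using Suc.IH by simp
  qed simp
  finally show ?thesis .
qed

text \<open>The tail of an orbit segment influences its Birkhoff sum at most logarithmically, because the errors
from \<open>phi_shadow\<close> telescope. This is where the precise form of the potential enters: the
exponential of the error grows only polynomially.\<close>

lemma birkhoff_sum_phi_shadow:
  assumes "subshift K" "initial n x = initial n y"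
  shows "birkhoff_sum n (\<phi>\<^sub>0 K) y \<le> birkhoff_sum n (\<phi>\<^sub>0 K) x + ln ((real n + 2) / 2)"
  unfolding birkhoff_sum_def sum_ln_telescope[symmetric] sum.distrib[symmetric]
proof (rule sum_mono)
  fix k assume "k \<in> {..<n}"
  then have "initial (n - k) ((shift ^^ k) x) = initial (n - k) ((shift ^^ k) y)"
    by (intro initial_shift_cong[OF assms(2)]) simp
  then show "\<phi>\<^sub>0 K ((shift ^^ k) y) \<le> \<phi>\<^sub>0 K ((shift ^^ k) x) + ln (1 + 1 / (real (n - k) + 1))"
    by (rule phi_shadow[OF assms(1)])
qed

lemma shift_funpow_subshift: "subshift K \<Longrightarrow> x \<in> K \<Longrightarrow> (shift ^^ k) x \<in> K"
  by (induction k) (auto simp: subshift_def)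

lemma screened_phi:
  fixes K :: "'a seq set"
  assumes K: "subshift K" and w: "cylinder w \<inter> K = {}"
  shows "screened (cylinder w) (\<phi>\<^sub>0 K)"
  unfolding screened_def
proof (intro allI ballI)
  fix u :: "'a list" and x x' :: "'a seq" assume x: "x \<in> cylinder w" "x' \<in> cylinder w"
  let ?N = "length u + length w"
  \<comment> \<open>A point of \<open>K\<close> starting with \<open>u @ w\<close> would be shifted into \<open>cylinder w \<inter> K\<close>.\<close>
  note eq = initial_prepend_cylinder[OF x(1), of u] initial_prepend_cylinder[OF x(2), of u]
  have "initial ?N (prepend u x) \<notin> initial ?N ` K"
  proof
    assume "initial ?N (prepend u x) \<in> initial ?N ` K"
    then obtain y where y: "y \<in> K" "u @ w = initial ?N y" unfolding eq by blast
    then have "initial (length w) ((shift ^^ length u) y) = w"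
      using initial_shift[of "length u" "length w" ?N y] by (simp add: y(2)[symmetric])
    then have "(shift ^^ length u) y \<in> cylinder w" by (simp add: mem_cylinder_iff)
    then show False using shift_funpow_subshift[OF K y(1)] w by blast
  qed
  then show "\<phi>\<^sub>0 K (prepend u x) = \<phi>\<^sub>0 K (prepend u x')"
    by (rule phi_cong[OF K]) (simp only: eq)
qed

text \<open>By \<open>phi_shadow\<close> the potential is a uniform limit of functions of finitely many coordinates.\<close>

lemma phi_measurable [measurable]:
  fixes K :: "'a::finite seq set"
  assumes "subshift K"
  shows "\<phi>\<^sub>0 K \<in> borel_measurable seq_borel"
proof (rule borel_measurable_LIMSEQ_real)
  fix x :: "'a seq"
  let ?f = "\<lambda>n. \<phi>\<^sub>0 K (prepend (initial n x) undefined)"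
  have "(\<lambda>n. 1 / (real n + 1)) \<longlonglongrightarrow> 0"
    using LIMSEQ_inverse_real_of_nat by (simp add: inverse_eq_divide add.commute)
  then have "(\<lambda>n. ln (1 + 1 / (real n + 1))) \<longlonglongrightarrow> ln (1 + 0)"
    by (intro tendsto_intros) auto
  then have lim: "(\<lambda>n. ln (1 + 1 / (real n + 1))) \<longlonglongrightarrow> 0" by simp
  have "\<bar>?f n - \<phi>\<^sub>0 K x\<bar> \<le> ln (1 + 1 / (real n + 1))" for n
  proof -
    have "initial n (prepend (initial n x) undefined) = initial n x" by simp
    from phi_shadow[OF assms this] phi_shadow[OF assms this[symmetric]]
    show ?thesis by linarith
  qed
  then have "(\<lambda>n. ?f n - \<phi>\<^sub>0 K x) \<longlonglongrightarrow> 0"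
    by (intro Lim_null_comparison[OF _ lim]) auto
  then show "?f \<longlonglongrightarrow> \<phi>\<^sub>0 K x" by (rule LIM_zero_cancel)
next
  fix n
  have "(\<lambda>x. \<phi>\<^sub>0 K (prepend (initial n x) undefined)) \<in> measurable seq_borel (count_space UNIV)"
    by (rule measurable_if_initial[of n]) simp
  then show "(\<lambda>x. \<phi>\<^sub>0 K (prepend (initial n x) undefined)) \<in> borel_measurable seq_borel"
    using measurable_compose[OF _ measurable_count_space] by fastforce
qed

section \<open>Entropy estimates for invariant measures\<close>

text \<open>The Gibbs inequality for a joint distribution \<open>p\<close> in which only the entropy of the first marginal is
counted. Since \<open>p a u\<close> is at most that marginal, the bound is as good as for the marginal alone,
and the second variable may be used freely in the weights.\<close>

lemma gibbs_inequality:
  fixes p F :: "'b \<Rightarrow> 'c \<Rightarrow> real"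
  assumes fin: "finite T" "finite U" and p: "\<And>a u. 0 \<le> p a u"
    and one: "(\<Sum>a\<in>T. \<Sum>u\<in>U. p a u) = 1"
  shows "(\<Sum>a\<in>T. - ((\<Sum>u\<in>U. p a u) * ln (\<Sum>u\<in>U. p a u))) + (\<Sum>a\<in>T. \<Sum>u\<in>U. p a u * F a u)
    \<le> ln (\<Sum>a\<in>T. \<Sum>u\<in>U. exp (F a u))"
proof -
  define q where "q a = (\<Sum>u\<in>U. p a u)" for a
  define S where "S = (\<Sum>a\<in>T. \<Sum>u\<in>U. exp (F a u))"
  have "T \<noteq> {}" "U \<noteq> {}" using one by auto
  then have S: "0 < S"
    unfolding S_def using fin by (intro sum_pos) auto
  have each: "- (p a u * ln (q a)) + p a u * F a u - p a u * ln S \<le> exp (F a u) / S - p a u"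
    if u: "u \<in> U" for a u
  proof (cases "p a u = 0")
    case True
    then show ?thesis using S by simp
  next
    case False
    then have pos: "0 < p a u" using p[of a u] by simp
    have le: "p a u \<le> q a"
      unfolding q_def using fin(2) u p by (intro member_le_sum) auto
    then have q: "0 < q a" using pos by simp
    have "F a u - ln S - ln (q a) = ln (exp (F a u) / (S * q a))"
      using S q by (simp add: ln_div ln_mult_pos)
    also have "\<dots> \<le> exp (F a u) / (S * q a) - 1"
      using S q by (intro ln_le_minus_one) simp
    finally have "p a u * (F a u - ln S - ln (q a)) \<le> p a u * (exp (F a u) / (S * q a) - 1)"
      using pos by (intro mult_left_mono) auto
    also have "\<dots> = (p a u / q a) * (exp (F a u) / S) - p a u"
      by (simp add: field_simps)
    also have "\<dots> \<le> 1 * (exp (F a u) / S) - p a u"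
      using le q S by (intro diff_right_mono mult_right_mono) auto
    finally show ?thesis by (simp add: algebra_simps)
  qed
  have "(\<Sum>a\<in>T. \<Sum>u\<in>U. - (p a u * ln (q a)) + p a u * F a u - p a u * ln S)
      \<le> (\<Sum>a\<in>T. \<Sum>u\<in>U. exp (F a u) / S - p a u)"
    by (intro sum_mono each)
  also have "\<dots> = S / S - 1"
    using one by (simp only: sum_subtractf sum_divide_distrib[symmetric] S_def[symmetric])
  also have "\<dots> = 0" using S by simp
  also have "(\<Sum>a\<in>T. \<Sum>u\<in>U. - (p a u * ln (q a)) + p a u * F a u - p a u * ln S) =
      (\<Sum>a\<in>T. - (q a * ln (q a))) + (\<Sum>a\<in>T. \<Sum>u\<in>U. p a u * F a u) - ln S"
  proof -
    have "(\<Sum>a\<in>T. \<Sum>u\<in>U. p a u * ln S) = ln S"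
      by (simp only: sum_distrib_right[symmetric] one mult_1)
    moreover have "(\<Sum>a\<in>T. \<Sum>u\<in>U. - (p a u * ln (q a))) = (\<Sum>a\<in>T. - (q a * ln (q a)))"
      by (simp only: sum_negf sum_distrib_right[symmetric] q_def[symmetric])
    ultimately show ?thesis
      by (simp only: sum_subtractf sum.distrib)
  qed
  finally show ?thesis by (simp add: q_def S_def)
qed

lemma (in finite_measure) integral_finite_range:
  fixes f :: "'b \<Rightarrow> real"
  assumes R: "finite R" "\<And>x. x \<in> space M \<Longrightarrow> h x \<in> R"
    and meas: "\<And>r. r \<in> R \<Longrightarrow> {x \<in> space M. h x = r} \<in> sets M"
  shows "integrable M (\<lambda>x. f (h x))"
    and "(\<integral>x. f (h x) \<partial>M) = (\<Sum>r\<in>R. measure M {x \<in> space M. h x = r} * f r)"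
proof -
  let ?f = "\<lambda>x. \<Sum>r\<in>R. indicator {x \<in> space M. h x = r} x * f r"
  have eq: "f (h x) = ?f x" if "x \<in> space M" for x
  proof -
    have "?f x = (\<Sum>r\<in>R. if r = h x then f r else 0)"
      using that by (intro sum.cong) auto
    then show ?thesis using R that by simp
  qed
  have int: "integrable M (\<lambda>x. indicator {x \<in> space M. h x = r} x * f r)" if "r \<in> R" for r
    using meas[OF that] by (intro integrable_mult_left integrable_real_indicator) (auto simp: emeasure_eq_measure)
  have "integrable M ?f"
    by (intro Bochner_Integration.integrable_sum int)
  then show "integrable M (\<lambda>x. f (h x))"
    by (subst Bochner_Integration.integrable_cong[OF refl eq])
  have "(\<integral>x. f (h x) \<partial>M) = (\<integral>x. ?f x \<partial>M)"
    by (rule Bochner_Integration.integral_cong[OF refl eq])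
  also have "\<dots> = (\<Sum>r\<in>R. \<integral>x. indicator {x \<in> space M. h x = r} x * f r \<partial>M)"
    by (rule Bochner_Integration.integral_sum) (rule int)
  also have "\<dots> = (\<Sum>r\<in>R. measure M {x \<in> space M. h x = r} * f r)"
  proof (intro sum.cong refl)
    fix r assume "r \<in> R"
    have "{x \<in> space M. h x = r} \<inter> space M = {x \<in> space M. h x = r}" by blast
    then show "(\<integral>x. indicator {x \<in> space M. h x = r} x * f r \<partial>M) =
        measure M {x \<in> space M. h x = r} * f r"
      by simp
  qed
  finally show "(\<integral>x. f (h x) \<partial>M) = (\<Sum>r\<in>R. measure M {x \<in> space M. h x = r} * f r)" .
qed

lemma invariant_measure_sets:
  assumes "invariant_measure \<mu>"
  shows "prob_space \<mu>" "sets \<mu> = sets seq_borel" "space \<mu> = UNIV"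
proof -
  show p: "prob_space \<mu>" and s: "sets \<mu> = sets seq_borel"
    using assms by (auto simp: invariant_measure_def)
  show "space \<mu> = UNIV" using sets_eq_imp_space_eq[OF s] by simp
qed

lemma measurable_shift_funpow [measurable]:
  "(shift ^^ k) \<in> measurable (seq_borel :: 'a::finite seq measure) seq_borel"
  by (rule measurable_compose_n) (rule measurable_shift)

lemma integral_shift_funpow:
  fixes f :: "'a::finite seq \<Rightarrow> real"
  assumes \<mu>: "invariant_measure \<mu>" and f: "f \<in> borel_measurable seq_borel"
  shows "(\<integral>x. f ((shift ^^ k) x) \<partial>\<mu>) = (\<integral>x. f x \<partial>\<mu>)"
proof (induction k)
  case (Suc k)
  note s = invariant_measure_sets[OF \<mu>]
  have m: "shift \<in> measurable \<mu> \<mu>" "(\<lambda>x. f ((shift ^^ k) x)) \<in> borel_measurable \<mu>"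
    using measurable_shift measurable_compose[OF measurable_shift_funpow f]
    unfolding measurable_cong_sets[OF s(2) s(2)] measurable_cong_sets[OF s(2) refl, of borel] .
  have "(\<integral>x. f ((shift ^^ Suc k) x) \<partial>\<mu>) = (\<integral>x. f ((shift ^^ k) (shift x)) \<partial>\<mu>)"
    by (simp only: funpow_Suc_right comp_def)
  also have "\<dots> = (\<integral>x. f ((shift ^^ k) x) \<partial>(distr \<mu> \<mu> shift))"
    by (rule integral_distr[OF m, symmetric])
  also have "distr \<mu> \<mu> shift = \<mu>"
    using \<mu> by (simp add: invariant_measure_def)
  finally show ?case using Suc by simp
qed simp

lemma partition_entropy_nonneg:
  assumes "prob_space \<mu>"
  shows "0 \<le> partition_entropy \<mu> P"
  unfolding partition_entropy_def
proof (rule sum_nonneg)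
  interpret prob_space \<mu> by fact
  fix A
  show "0 \<le> - (prob A * ln (prob A))"
  proof (cases "prob A = 0")
    case False
    then have "0 < prob A" by (simp add: zero_less_measure_iff)
    then have "ln (prob A) \<le> 0" using prob_le_1 by simp
    then show ?thesis by (simp add: mult_nonneg_nonpos)
  qed simp
qed

lemma kolmogorov_entropy_nonneg:
  assumes "invariant_measure \<mu>"
  shows "0 \<le> kolmogorov_entropy \<mu>"
proof -
  note s = invariant_measure_sets[OF assms]
  have P: "finite_partition \<mu> {UNIV}"
    using sets.top[of \<mu>] by (simp add: finite_partition_def partition_on_def s(3) disjoint_def)
  have "0 \<le> limsup (\<lambda>n. ereal (partition_entropy \<mu> (dynamical_join n {UNIV}) / real n))"
    by (rule le_Limsup)
      (auto intro!: always_eventually divide_nonneg_nonneg partition_entropy_nonneg[OF s(1)])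
  also have "\<dots> \<le> kolmogorov_entropy \<mu>"
    unfolding kolmogorov_entropy_def using P by (intro SUP_upper) simp
  finally show ?thesis .
qed

text \<open>A point is labelled by its atom of \<open>P\<close>, and the atoms of the \<open>n\<close>-th dynamical join are the sets of
points with equal label sequences of length \<open>n\<close>.\<close>

locale labelled_partition =
  fixes \<mu> :: "'a::finite seq measure" and P :: "'a seq set set"
  assumes inv: "invariant_measure \<mu>" and part: "finite_partition \<mu> P"
begin

sublocale prob_space \<mu>
  by (rule invariant_measure_sets[OF inv])

lemma sets_eq: "sets \<mu> = sets seq_borel" and space_UNIV [simp]: "space \<mu> = UNIV"
  by (rule invariant_measure_sets[OF inv])+

lemma finite_P [simp]: "finite P"
  using part by (simp add: finite_partition_def)

lemma P_sets: "A \<in> P \<Longrightarrow> A \<in> sets \<mu>"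
  using part by (auto simp: finite_partition_def)

definition label :: "'a seq \<Rightarrow> 'a seq set" where
  "label x = (THE A. A \<in> P \<and> x \<in> A)"

lemma label_eq: "A \<in> P \<Longrightarrow> x \<in> A \<Longrightarrow> label x = A"
proof -
  assume A: "A \<in> P" "x \<in> A"
  have "disjoint P" using part by (simp add: finite_partition_def partition_on_def)
  then have uniq: "B = A" if "B \<in> P \<and> x \<in> B" for B
    using that A disjointD[of P B A] by blast
  show ?thesis
    unfolding label_def
  proof (rule the_equality)
    show "A \<in> P \<and> x \<in> A" using A by simp
  qed (rule uniq)
qed

lemma label_in: "label x \<in> P" "x \<in> label x"
proof -
  have "x \<in> \<Union> P" using part by (simp add: finite_partition_def partition_on_def)
  then obtain A where "A \<in> P" "x \<in> A" by blast
  then show "label x \<in> P" "x \<in> label x" using label_eq by metis+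
qed

lemma label_eq_iff: "A \<in> P \<Longrightarrow> label x = A \<longleftrightarrow> x \<in> A"
  using label_eq label_in(2) by metis

lemma shift_vimage_sets: "A \<in> sets \<mu> \<Longrightarrow> (shift ^^ k) -` A \<in> sets \<mu>"
  using measurable_sets[OF measurable_shift_funpow, of A k] by (simp add: sets_eq)

lemma initial_vimage_sets: "initial n -` S \<in> sets \<mu>"
  using measurable_sets[OF measurable_initial, of S n] by (simp add: sets_eq)

definition itinerary :: "nat \<Rightarrow> 'a seq \<Rightarrow> nat \<Rightarrow> 'a seq set" where
  "itinerary n x = (\<lambda>i\<in>{..<n}. label ((shift ^^ i) x))"

abbreviation itineraries :: "nat \<Rightarrow> (nat \<Rightarrow> 'a seq set) set" where
  "itineraries n \<equiv> {..<n} \<rightarrow>\<^sub>E P"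

lemma itinerary_in: "itinerary n x \<in> itineraries n"
  by (simp add: itinerary_def label_in)

lemma finite_itineraries: "finite (itineraries n)"
  by (intro finite_PiE) auto

lemma itinerary_eq_iff:
  assumes "a \<in> itineraries n"
  shows "itinerary n x = a \<longleftrightarrow> x \<in> (\<Inter>i<n. (shift ^^ i) -` a i)"
proof -
  have "itinerary n x = a \<longleftrightarrow> (\<forall>i<n. label ((shift ^^ i) x) = a i)"
  proof
    assume "\<forall>i<n. label ((shift ^^ i) x) = a i"
    then show "itinerary n x = a"
      by (intro PiE_ext[OF itinerary_in assms]) (simp add: itinerary_def)
  qed (auto simp: itinerary_def)
  also have "\<dots> \<longleftrightarrow> (\<forall>i<n. (shift ^^ i) x \<in> a i)"
    using assms by (auto simp: label_eq_iff PiE_iff)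
  finally show ?thesis by auto
qed

lemma itinerary_sets:
  assumes "a \<in> itineraries n"
  shows "{x. itinerary n x = a} \<in> sets \<mu>"
proof -
  have eq: "{x. itinerary n x = a} = (\<Inter>i<n. (shift ^^ i) -` a i)"
    using itinerary_eq_iff[OF assms] by blast
  have "(\<Inter>i<n. (shift ^^ i) -` a i) \<in> sets \<mu>"
  proof (cases "n = 0")
    case True
    then show ?thesis using sets.top[of \<mu>] by simp
  next
    case False
    then show ?thesis
      using assms by (intro sets.finite_INT shift_vimage_sets P_sets) (auto simp: PiE_iff)
  qed
  then show ?thesis by (simp only: eq)
qed

lemma dynamical_join_eq:
  "dynamical_join n P = (\<lambda>a. {x. itinerary n x = a}) ` range (itinerary n)"
proof (intro equalityI subsetI)
  fix C assume "C \<in> dynamical_join n P"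
  then obtain A where A: "C = (\<Inter>i<n. (shift ^^ i) -` A i)" "\<forall>i<n. A i \<in> P" "C \<noteq> {}"
    unfolding dynamical_join_def by blast
  let ?a = "restrict A {..<n}"
  have a: "?a \<in> itineraries n" using A(2) by simp
  have C: "C = {x. itinerary n x = ?a}"
    unfolding itinerary_eq_iff[OF a] A(1) by auto
  moreover obtain x where "x \<in> C" using A(3) by blast
  ultimately have "itinerary n x = ?a" by simp
  then have "?a \<in> range (itinerary n)" by (metis rangeI)
  then show "C \<in> (\<lambda>a. {x. itinerary n x = a}) ` range (itinerary n)"
    using C by blast
next
  fix C assume "C \<in> (\<lambda>a. {x. itinerary n x = a}) ` range (itinerary n)"
  then obtain y where C: "C = {x. itinerary n x = itinerary n y}" by blast
  have "C = (\<Inter>i<n. (shift ^^ i) -` itinerary n y i)"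
    unfolding C itinerary_eq_iff[OF itinerary_in] by blast
  moreover have "\<forall>i<n. itinerary n y i \<in> P"
    by (simp add: itinerary_def label_in)
  moreover have "C \<noteq> {}" unfolding C by blast
  ultimately show "C \<in> dynamical_join n P"
    unfolding dynamical_join_def by blast
qed

lemma partition_entropy_join:
  "partition_entropy \<mu> (dynamical_join n P) =
    (\<Sum>a\<in>itineraries n. - (prob {x. itinerary n x = a} * ln (prob {x. itinerary n x = a})))"
proof -
  have "inj_on (\<lambda>a. {x. itinerary n x = a}) (range (itinerary n))"
    by (rule inj_onI) blast
  then have "partition_entropy \<mu> (dynamical_join n P) =
      (\<Sum>a\<in>range (itinerary n). - (prob {x. itinerary n x = a} * ln (prob {x. itinerary n x = a})))"
    unfolding partition_entropy_def dynamical_join_eq by (simp add: sum.reindex)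
  also have "\<dots> = (\<Sum>a\<in>itineraries n. - (prob {x. itinerary n x = a} * ln (prob {x. itinerary n x = a})))"
  proof (rule sum.mono_neutral_left[OF finite_itineraries])
    show "range (itinerary n) \<subseteq> itineraries n" using itinerary_in by blast
    show "\<forall>a\<in>itineraries n - range (itinerary n).
        - (prob {x. itinerary n x = a} * ln (prob {x. itinerary n x = a})) = 0"
    proof
      fix a assume "a \<in> itineraries n - range (itinerary n)"
      then have "{x. itinerary n x = a} = {}" by blast
      then show "- (prob {x. itinerary n x = a} * ln (prob {x. itinerary n x = a})) = 0"
        by (simp only: measure_empty)
    qed
  qed
  finally show ?thesis .
qed

text \<open>The partition need not be made of cylinders, but a long initial word predicts the label with small
error, because the cylinders generate the Borel sets.\<close>

lemma predictor_exists:
  assumes "0 < e"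
  obtains m c where "prob {x. label x \<noteq> c (initial m x)} \<le> e"
proof -
  have "P \<noteq> {}" using label_in by blast
  then have r: "0 < card P" by (simp add: card_gt_0_iff)
  have "\<exists>n S. prob (sym_diff A (initial n -` S)) \<le> e / card P" if A: "A \<in> P" for A
  proof -
    have "0 < e / card P" using assms r by simp
    then obtain n S where "prob (sym_diff A (initial n -` S)) \<le> e / card P"
      by (rule approx_by_words[OF prob_space_axioms sets_eq P_sets[OF A]])
    then show ?thesis by blast
  qed
  then obtain n S where nS: "\<And>A. A \<in> P \<Longrightarrow> prob (sym_diff A (initial (n A) -` S A)) \<le> e / card P"
    by metis
  define m where "m = Max (n ` P)"
  \<comment> \<open>Outside the exceptional set exactly one atom satisfies this, so the choice does not matter there.\<close>
  define c where "c u = (SOME A. A \<in> P \<and> take (n A) u \<in> S A)" for u :: "'a list"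
  let ?D = "\<Union>A\<in>P. sym_diff A (initial (n A) -` S A)"
  have "{x. label x \<noteq> c (initial m x)} \<subseteq> ?D"
  proof (rule subsetI, rule ccontr)
    fix x assume x: "x \<in> {x. label x \<noteq> c (initial m x)}" "x \<notin> ?D"
    have "take (n A) (initial m x) = initial (n A) x" if "A \<in> P" for A
      using initial_shift[of 0 "n A" m x] that by (simp add: m_def)
    then have "A \<in> P \<and> take (n A) (initial m x) \<in> S A \<longleftrightarrow> A \<in> P \<and> x \<in> A" for A
      using x(2) by auto
    then have "A \<in> P \<and> take (n A) (initial m x) \<in> S A \<longleftrightarrow> A = label x" for A
      using label_eq_iff label_in by metis
    then have "c (initial m x) = label x"
      unfolding c_def by simp
    then show False using x(1) by simp
  qed
  moreover have D: "sym_diff A (initial (n A) -` S A) \<in> sets \<mu>" if "A \<in> P" for A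
    using P_sets[OF that] initial_vimage_sets by blast
  ultimately have "prob {x. label x \<noteq> c (initial m x)} \<le> prob ?D"
    by (intro finite_measure_mono sets.finite_UN) auto
  also have "\<dots> \<le> (\<Sum>A\<in>P. prob (sym_diff A (initial (n A) -` S A)))"
    using D by (intro finite_measure_subadditive_finite) auto
  also have "\<dots> \<le> (\<Sum>A\<in>P. e / card P)" by (intro sum_mono nS)
  also have "\<dots> = e" using \<open>P \<noteq> {}\<close> by simp
  finally show ?thesis by (rule that)
qed

lemma misprediction_sets: "{x. label x \<noteq> c (initial m x)} \<in> sets \<mu>"
proof -
  have "{x. label x \<noteq> c (initial m x)} = UNIV - (\<Union>A\<in>P. A \<inter> initial m -` (c -` {A}))"
  proof -
    have "label x \<noteq> v \<longleftrightarrow> \<not> (\<exists>A\<in>P. x \<in> A \<and> v = A)" for x v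
      using label_eq label_in by metis
    then show ?thesis by auto
  qed
  moreover have "(\<Union>A\<in>P. A \<inter> initial m -` (c -` {A})) \<in> sets \<mu>"
    using P_sets initial_vimage_sets by (intro sets.finite_UN sets.Int) auto
  ultimately show ?thesis
    using sets.compl_sets[of "\<Union>A\<in>P. A \<inter> initial m -` (c -` {A})" \<mu>] by simp
qed

text \<open>Each wrong guess of the predicted labels \<open>b\<close> costs the factor \<open>exp (- t)\<close>, so the label sequences
together weigh little more than the one that is guessed.\<close>

lemma sum_exp_misprediction:
  "(\<Sum>a\<in>itineraries n. exp (- (t * (\<Sum>i<n. of_bool (a i \<noteq> b i))))) \<le> exp (n * (card P * exp (- t)))"
proof -
  have "(\<Sum>a\<in>itineraries n. exp (- (t * (\<Sum>i<n. of_bool (a i \<noteq> b i))))) =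
      (\<Sum>a\<in>itineraries n. \<Prod>i<n. exp (- (t * of_bool (a i \<noteq> b i))))"
    by (simp only: exp_sum[OF finite_lessThan] sum_distrib_left sum_negf[symmetric])
  also have "\<dots> = (\<Prod>i<n. \<Sum>A\<in>P. exp (- (t * of_bool (A \<noteq> b i))))"
    by (rule prod_sum_PiE[symmetric]) auto
  also have "\<dots> \<le> (\<Prod>i<n. exp (card P * exp (- t)))"
  proof (intro prod_mono conjI sum_nonneg)
    fix i
    have "(\<Sum>A\<in>P. exp (- (t * of_bool (A \<noteq> b i)))) \<le> (\<Sum>A\<in>P. of_bool (A = b i) + exp (- t))"
      by (intro sum_mono) auto
    also have "\<dots> = (\<Sum>A\<in>P. of_bool (A = b i)) + card P * exp (- t)"
      by (simp add: sum.distrib)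
    also have "(\<Sum>A\<in>P. of_bool (A = b i)) \<le> (1 :: real)"
      by (simp add: of_bool_def)
    also have "1 + card P * exp (- t) \<le> exp (card P * exp (- t))"
      by (rule exp_ge_add_one_self)
    finally show "(\<Sum>A\<in>P. exp (- (t * of_bool (A \<noteq> b i)))) \<le> exp (card P * exp (- t))" by simp
  qed simp
  also have "\<dots> = exp (n * (card P * exp (- t)))"
    by (simp add: exp_of_nat_mult)
  finally show ?thesis .
qed

text \<open>The Gibbs inequality is applied to the pair (itinerary, initial word), with weight \<open>W\<close> on the word
and the misprediction penalty on the itinerary. The word has \<open>m\<close> letters more than the itinerary,
so that all labels can be predicted from it. Invariance turns the Birkhoff sum of \<open>g\<close> and the number of
mispredictions into multiples of integrals.\<close>

lemma partition_entropy_bound: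
  assumes g: "g \<in> borel_measurable seq_borel" "\<And>x. \<bar>g x\<bar> \<le> B"
    and dom: "\<And>n x. birkhoff_sum n g x \<le> W (initial n x)"
    and wt: "\<And>n. (\<Sum>u\<in>words n. exp (W u)) \<le> exp (c n)"
    and t: "0 \<le> t" and err: "prob {x. label x \<noteq> pred (initial m x)} \<le> e"
  shows "partition_entropy \<mu> (dynamical_join n P)
    \<le> c (n + m) + n * (card P * exp (- t)) + n * (t * e) - (n + m) * (\<integral>x. g x \<partial>\<mu>)"
proof -
  define N where "N = n + m"
  define F where "F a u = W u - t * (\<Sum>i<n. of_bool (a i \<noteq> pred (take m (drop i u))))"
    for a :: "nat \<Rightarrow> 'a seq set" and u
  define h where "h x = (itinerary n x, initial N x)" for x
  define R where "R = itineraries n \<times> (words N :: 'a list set)"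
  define p where "p a u = prob {x. h x = (a, u)}" for a u
  have finR: "finite R" by (simp add: R_def finite_itineraries)
  have hR: "h x \<in> R" for x by (simp add: h_def R_def itinerary_in del: PiE_iff)
  have hsets: "{x \<in> space \<mu>. h x = r} \<in> sets \<mu>" if "r \<in> R" for r
  proof -
    obtain a u where r: "r = (a, u)" "a \<in> itineraries n" using \<open>r \<in> R\<close> unfolding R_def by blast
    have "{x \<in> space \<mu>. h x = r} = {x. itinerary n x = a} \<inter> initial N -` {u}"
      by (auto simp: h_def r(1))
    then show ?thesis using itinerary_sets[OF r(2)] initial_vimage_sets by auto
  qed
  have expect: "integrable \<mu> (\<lambda>x. f (h x))"
    "(\<integral>x. f (h x) \<partial>\<mu>) = (\<Sum>a\<in>itineraries n. \<Sum>u\<in>words N. p a u * f (a, u))" for f :: "_ \<Rightarrow> real"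
    using integral_finite_range[OF finR hR hsets, of f]
    by (simp_all add: p_def R_def sum.cartesian_product)
  have marg: "(\<Sum>u\<in>words N. p a u) = prob {x. itinerary n x = a}" if "a \<in> itineraries n" for a
  proof -
    have "prob {x. itinerary n x = a} = (\<integral>x. indicator {x. itinerary n x = a} x \<partial>\<mu>)"
      using itinerary_sets[OF that] by simp
    also have "\<dots> = (\<integral>x. of_bool (fst (h x) = a) \<partial>\<mu>)"
      by (intro Bochner_Integration.integral_cong) (auto simp: h_def)
    also have "\<dots> = (\<Sum>a'\<in>itineraries n. if a' = a then \<Sum>u\<in>words N. p a' u else 0)"
      unfolding expect(2)[of "\<lambda>r. of_bool (fst r = a)"] by (intro sum.cong refl) simp
    also have "\<dots> = (\<Sum>u\<in>words N. p a u)"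
      using that finite_itineraries[of n] by simp
    finally show ?thesis by simp
  qed
  have one: "(\<Sum>a\<in>itineraries n. \<Sum>u\<in>words N. p a u) = 1"
    using expect(2)[of "\<lambda>_. 1"] prob_space by simp
  have "(\<Sum>a\<in>itineraries n. - ((\<Sum>u\<in>words N. p a u) * ln (\<Sum>u\<in>words N. p a u)))
      + (\<Sum>a\<in>itineraries n. \<Sum>u\<in>words N. p a u * F a u)
      \<le> ln (\<Sum>a\<in>itineraries n. \<Sum>u\<in>words N. exp (F a u))"
    by (rule gibbs_inequality[OF finite_itineraries finite_words _ one]) (simp add: p_def)
  also have "(\<Sum>a\<in>itineraries n. - ((\<Sum>u\<in>words N. p a u) * ln (\<Sum>u\<in>words N. p a u))) =
      partition_entropy \<mu> (dynamical_join n P)"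
    unfolding partition_entropy_join by (intro sum.cong refl) (simp only: marg)
  also have "(\<Sum>a\<in>itineraries n. \<Sum>u\<in>words N. p a u * F a u) = (\<integral>x. F (itinerary n x) (initial N x) \<partial>\<mu>)"
    using expect(2)[of "\<lambda>(a, u). F a u"] by (simp add: h_def)
  finally have gibbs: "partition_entropy \<mu> (dynamical_join n P) + (\<integral>x. F (itinerary n x) (initial N x) \<partial>\<mu>)
      \<le> ln (\<Sum>a\<in>itineraries n. \<Sum>u\<in>words N. exp (F a u))" .
  have "(\<Sum>a\<in>itineraries n. \<Sum>u\<in>words N. exp (F a u)) =
      (\<Sum>u\<in>words N. exp (W u) * (\<Sum>a\<in>itineraries n.
        exp (- (t * (\<Sum>i<n. of_bool (a i \<noteq> pred (take m (drop i u))))))))"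
    unfolding sum_distrib_left F_def
    by (subst sum.swap) (intro sum.cong refl, simp only: exp_add[symmetric] diff_conv_add_uminus)
  also have "\<dots> \<le> (\<Sum>u\<in>words N. exp (W u) * exp (n * (card P * exp (- t))))"
    by (intro sum_mono mult_left_mono sum_exp_misprediction) simp
  also have "\<dots> \<le> exp (c N) * exp (n * (card P * exp (- t)))"
    unfolding sum_distrib_right[symmetric] by (intro mult_right_mono wt) simp
  finally have Z: "(\<Sum>a\<in>itineraries n. \<Sum>u\<in>words N. exp (F a u)) \<le> exp (c N + n * (card P * exp (- t)))"
    by (simp add: exp_add)
  have "itineraries n \<noteq> {}" "(words N :: 'a list set) \<noteq> {}"
    using itinerary_in initial_in_words by blast+
  then have Zpos: "0 < (\<Sum>a\<in>itineraries n. \<Sum>u\<in>words N. exp (F a u))"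
    by (intro sum_pos finite_itineraries finite_words) auto
  have lnZ: "ln (\<Sum>a\<in>itineraries n. \<Sum>u\<in>words N. exp (F a u)) \<le> c N + n * (card P * exp (- t))"
    using Z Zpos by (metis ln_exp ln_le_cancel_iff exp_gt_zero)
  let ?bad = "{x. label x \<noteq> pred (initial m x)}"
  note meas_cong = measurable_cong_sets[OF sets_eq refl]
  have ind: "indicat_real ?bad \<in> borel_measurable seq_borel"
    using misprediction_sets sets_eq by (intro borel_measurable_indicator) auto
  have int_g: "integrable \<mu> (\<lambda>x. g ((shift ^^ k) x))" for k
    using g measurable_compose[OF measurable_shift_funpow g(1)]
    by (intro integrable_const_bound[of _ B]) (auto simp: meas_cong)
  have int_b: "integrable \<mu> (\<lambda>x. indicat_real ?bad ((shift ^^ k) x))" for k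
    using measurable_compose[OF measurable_shift_funpow ind]
    by (intro integrable_const_bound[of _ 1]) (auto simp: meas_cong indicator_def)
  let ?G = "\<lambda>x. (\<Sum>k<N. g ((shift ^^ k) x)) - t * (\<Sum>i<n. indicat_real ?bad ((shift ^^ i) x))"
  have intG: "integrable \<mu> ?G"
    by (intro Bochner_Integration.integrable_diff Bochner_Integration.integrable_sum
        integrable_mult_right int_g int_b)
  have "(\<integral>x. ?G x \<partial>\<mu>) = (\<Sum>k<N. \<integral>x. g ((shift ^^ k) x) \<partial>\<mu>)
      - t * (\<Sum>i<n. \<integral>x. indicat_real ?bad ((shift ^^ i) x) \<partial>\<mu>)"
    by (simp add: Bochner_Integration.integral_diff Bochner_Integration.integral_sum int_g int_b
        Bochner_Integration.integrable_sum)
  also have "\<dots> = N * (\<integral>x. g x \<partial>\<mu>) - t * (n * prob ?bad)"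
    unfolding integral_shift_funpow[OF inv g(1)] integral_shift_funpow[OF inv ind]
    using misprediction_sets by simp
  finally have "(\<integral>x. ?G x \<partial>\<mu>) = N * (\<integral>x. g x \<partial>\<mu>) - t * (n * prob ?bad)" .
  moreover have "(\<integral>x. ?G x \<partial>\<mu>) \<le> (\<integral>x. F (itinerary n x) (initial N x) \<partial>\<mu>)"
  proof (rule integral_mono[OF intG])
    show "integrable \<mu> (\<lambda>x. F (itinerary n x) (initial N x))"
      using expect(1)[of "\<lambda>(a, u). F a u"] by (simp add: h_def)
    fix x
    have "(\<Sum>i<n. of_bool (itinerary n x i \<noteq> pred (take m (drop i (initial N x))))) =
        (\<Sum>i<n. indicat_real ?bad ((shift ^^ i) x))"
    proof (intro sum.cong refl)
      fix i assume "i \<in> {..<n}"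
      then have "i < n" "i + m \<le> N" by (simp_all add: N_def)
      then show "of_bool (itinerary n x i \<noteq> pred (take m (drop i (initial N x)))) =
          indicat_real ?bad ((shift ^^ i) x)"
        by (simp add: itinerary_def initial_shift[symmetric] indicator_def)
    qed
    then show "?G x \<le> F (itinerary n x) (initial N x)"
      using dom[of N x] by (simp add: F_def birkhoff_sum_def)
  qed
  moreover have "t * (n * prob ?bad) \<le> n * (t * e)"
  proof -
    have "(n * t) * prob ?bad \<le> (n * t) * e"
      by (rule mult_left_mono[OF err]) (use t in simp)
    then show ?thesis by (simp add: mult_ac)
  qed
  ultimately show ?thesis using gibbs lnZ by (simp add: N_def)
qed

end

text \<open>The easy half of the variational principle: \<open>h + \<integral> g \<le> P(g)\<close>, in the case that the partition
functions, with weights \<open>W\<close> dominating the Birkhoff sums, grow subexponentially. The penalty \<open>t\<close> is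
chosen first, to make the entropy of the mispredictions small, and the predictor afterwards, to make
their expected cost small.\<close>

lemma kolmogorov_entropy_le:
  fixes \<mu> :: "'a::finite seq measure"
  assumes inv: "invariant_measure \<mu>"
    and g: "g \<in> borel_measurable seq_borel" "\<And>x. \<bar>g x\<bar> \<le> B"
    and dom: "\<And>n x. birkhoff_sum n g x \<le> W (initial n x)"
    and wt: "\<And>n. (\<Sum>u\<in>words n. exp (W u)) \<le> exp (c n)"
    and c: "(\<lambda>n. c n / real n) \<longlonglongrightarrow> 0"
  shows "kolmogorov_entropy \<mu> \<le> ereal (- (\<integral>x. g x \<partial>\<mu>))"
  unfolding kolmogorov_entropy_def
proof (rule SUP_least)
  fix P assume "P \<in> {P. finite_partition \<mu> P}"
  then interpret labelled_partition \<mu> P by unfold_locales (use inv in auto)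
  let ?I = "\<integral>x. g x \<partial>\<mu>"
  let ?H = "\<lambda>n. partition_entropy \<mu> (dynamical_join n P)"
  have "limsup (\<lambda>n. ereal (?H n / n)) \<le> ereal (- ?I) + ereal d" if d: "0 < d" for d
  proof -
    define r where "r = real (card P)"
    \<comment> \<open>Large enough for \<open>r * exp (- t) \<le> d / 2\<close>; the summand \<open>1\<close> keeps \<open>t\<close> positive.\<close>
    define t where "t = 1 + \<bar>ln (2 * r / d)\<bar>"
    have "P \<noteq> {}" using label_in by blast
    then have r: "0 < r" by (simp add: r_def card_gt_0_iff)
    have t: "0 < t" by (simp add: t_def add_pos_nonneg)
    have "exp (- t) \<le> exp (- ln (2 * r / d))" by (simp add: t_def)
    also have "\<dots> = d / (2 * r)" using r d by (simp add: exp_minus)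
    finally have small: "r * exp (- t) \<le> d / 2" using r by (simp add: field_simps)
    obtain m pred where pred: "prob {x. label x \<noteq> pred (initial m x)} \<le> d / (2 * t)"
      by (rule predictor_exists[of "d / (2 * t)"]) (use d t in simp)
    have bound: "?H n \<le> c (n + m) + n * d - (n + m) * ?I" for n
    proof -
      have "?H n \<le> c (n + m) + n * (r * exp (- t)) + n * (t * (d / (2 * t))) - (n + m) * ?I"
        unfolding r_def
        using partition_entropy_bound[where g = g and W = W and c = c and t = t, OF g dom wt _ pred] t
        by simp
      also have "n * (r * exp (- t)) \<le> n * (d / 2)" by (rule mult_left_mono[OF small]) simp
      finally show ?thesis using t by (simp add: mult.commute)
    qed
    have "(\<lambda>n. c (n + m) / real (n + m) * (real (n + m) / real n) + d - real (n + m) / real n * ?I)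
        \<longlonglongrightarrow> 0 * 1 + d - 1 * ?I"
    proof (intro tendsto_intros)
      show "(\<lambda>n. c (n + m) / real (n + m)) \<longlonglongrightarrow> 0" using c by (rule LIMSEQ_ignore_initial_segment)
      show ratio: "(\<lambda>n. real (n + m) / real n) \<longlonglongrightarrow> 1"
        by real_asymp
      show "(\<lambda>n. real (n + m) / real n) \<longlonglongrightarrow> 1" by (rule ratio)
    qed
    then have lim: "(\<lambda>n. ereal (c (n + m) / real (n + m) * (real (n + m) / real n) + d - real (n + m) / real n * ?I))
        \<longlonglongrightarrow> ereal (- ?I + d)" by simp
    have "\<forall>\<^sub>F n in sequentially. ereal (?H n / n) \<le>
        ereal (c (n + m) / real (n + m) * (real (n + m) / real n) + d - real (n + m) / real n * ?I)"
      using eventually_gt_at_top[of 0]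
    proof eventually_elim
      case (elim n)
      have "?H n / n \<le> (c (n + m) + n * d - (n + m) * ?I) / n"
        by (rule divide_right_mono[OF bound]) simp
      also have "\<dots> = c (n + m) / real (n + m) * (real (n + m) / real n) + d - real (n + m) / real n * ?I"
      proof -
        have "(x + n * d - y * ?I) / n = x / y * (y / n) + d - y / n * ?I" if "0 < y" for x y :: real
          using that elim by (simp add: field_simps)
        then show ?thesis using elim by simp
      qed
      finally show ?case by simp
    qed
    then have "limsup (\<lambda>n. ereal (?H n / n)) \<le> limsup (\<lambda>n. ereal (c (n + m) / real (n + m) * (real (n + m) / real n) + d - real (n + m) / real n * ?I))"
      by (rule Limsup_mono)
    also have "\<dots> = ereal (- ?I + d)"
      by (rule lim_imp_Limsup[OF _ lim]) simp
    finally show ?thesis by simp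
  qed
  then show "limsup (\<lambda>n. ereal (?H n / n)) \<le> ereal (- ?I)"
    by (rule ereal_le_epsilon2)
qed

section \<open>Free energy, pressure and equilibrium measures\<close>

lemma V0_eq: "V\<^sub>0 K = (\<lambda>x. - \<phi>\<^sub>0 K x)"
  by (rule ext) (simp add: V\<^sub>0_def)

lemma integrable_phi:
  fixes K :: "'a::finite seq set"
  assumes K: "subshift K" and \<mu>: "invariant_measure \<mu>"
  shows "integrable \<mu> (\<phi>\<^sub>0 K)"
proof -
  note s = invariant_measure_sets[OF \<mu>]
  interpret prob_space \<mu> by (rule s)
  show ?thesis
    using phi_measurable[OF K] phi_nonneg[OF K] phi_le_ln2[OF K]
    by (intro integrable_const_bound[of _ "ln 2"]) (simp_all add: measurable_cong_sets[OF s(2) refl])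
qed

lemma integral_phi_nonneg: "subshift K \<Longrightarrow> 0 \<le> (\<integral>x. \<phi>\<^sub>0 K x \<partial>\<mu>)"
  by (intro Bochner_Integration.integral_nonneg phi_nonneg)

text \<open>Only the last \<open>length w\<close> positions can see letters beyond the common prefix.\<close>

lemma birkhoff_sum_indicator_cylinder:
  assumes "initial n x = initial n y"
  shows "birkhoff_sum n (indicator (cylinder w)) x
    \<le> birkhoff_sum n (indicator (cylinder w)) y + real (length w)"
proof -
  let ?late = "\<lambda>k. n < k + length w"
  have "birkhoff_sum n (indicator (cylinder w)) x
      \<le> (\<Sum>k<n. indicator (cylinder w) ((shift ^^ k) y) + of_bool (?late k))"
    unfolding birkhoff_sum_def
  proof (rule sum_mono)
    fix k
    show "indicat_real (cylinder w) ((shift ^^ k) x)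
        \<le> indicator (cylinder w) ((shift ^^ k) y) + of_bool (?late k)"
    proof (cases "?late k")
      case True
      then show ?thesis by (simp add: indicator_def)
    next
      case False
      then have "initial (length w) ((shift ^^ k) x) = initial (length w) ((shift ^^ k) y)"
        by (intro initial_shift_cong[OF assms]) simp
      then show ?thesis by (simp add: indicator_def mem_cylinder_iff)
    qed
  qed
  also have "\<dots> = birkhoff_sum n (indicator (cylinder w)) y + real (card ({..<n} \<inter> {k. ?late k}))"
    by (simp add: sum.distrib birkhoff_sum_def sum_of_bool_eq)
  also have "card ({..<n} \<inter> {k. ?late k}) \<le> card {n - length w..<n}"
    by (rule card_mono) auto
  also have "\<dots> \<le> length w" by simp
  finally show ?thesis by simp
qed

text \<open>An excursion between consecutive visits to \<open>J\<close> collects the bonus \<open>s\<close> exactly once.\<close>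

lemma first_return_sum_bonus:
  "first_return_sum (\<lambda>x. g x + s * indicator J x) J (Suc n) x
    = exp s * first_return_sum g J (Suc n) x"
  unfolding first_return_sum_def sum_distrib_left
proof (intro sum.cong refl)
  fix y assume "y \<in> {y \<in> J. return_time J y = Some (Suc n) \<and> (shift ^^ Suc n) y = x}"
  then have y: "y \<in> J" "return_time J y = Some (Suc n)" by simp_all
  have "birkhoff_sum (Suc n) (indicator J) y = (\<Sum>k<Suc n. if k = 0 then 1 else (0 :: real))"
    unfolding birkhoff_sum_def
  proof (intro sum.cong refl)
    fix k assume k: "k \<in> {..<Suc n}"
    show "indicat_real J ((shift ^^ k) y) = (if k = 0 then 1 else 0)"
    proof (cases "k = 0")
      case False
      then have "1 \<le> k \<and> k < Suc n" using k by simp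
      then have "(shift ^^ k) y \<notin> J" using y(2) unfolding return_time_Some_iff by blast
      then show ?thesis using False by simp
    qed (use y in simp)
  qed
  also have "\<dots> = 1" by (subst sum.delta) auto
  finally have "birkhoff_sum (Suc n) (\<lambda>x. g x + s * indicator J x) y = birkhoff_sum (Suc n) g y + s"
    by (simp only: birkhoff_sum_def sum.distrib sum_distrib_left[symmetric] mult_1_right)
  then show "exp (birkhoff_sum (Suc n) (\<lambda>x. g x + s * indicator J x) y)
      = exp s * exp (birkhoff_sum (Suc n) g y)"
    by (simp add: exp_add)
qed

text \<open>Strict inequality in the hypothesis leaves room for a bonus \<open>s > 0\<close> at each visit to the cylinder
while the first return sums still add up to at most one. The return sums, and with them the
partition functions of \<open>g = \<beta> V\<^sub>0 + s 1\<^sub>J\<close>, then grow at most polynomially, and the variational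
inequality for \<open>g\<close> is the claim.\<close>

lemma entropy_bound_with_bonus:
  fixes K :: "'a::finite seq set"
  assumes K: "subshift K" and w: "cylinder w \<inter> K = {}" and \<beta>: "0 \<le> \<beta>"
    and x: "x \<in> cylinder w"
    and less: "induced_transfer (cylinder w) 0 \<beta> (V\<^sub>0 K) (indicator (cylinder w)) x < 1"
  obtains s where "0 < s"
    "\<And>\<mu>. invariant_measure \<mu> \<Longrightarrow>
      kolmogorov_entropy \<mu> \<le> ereal (\<beta> * (\<integral>x. \<phi>\<^sub>0 K x \<partial>\<mu>) - s * measure \<mu> (cylinder w))"
proof -
  let ?J = "cylinder w" and ?m = "real (length w)"
  obtain q where q: "q < 1"
    "\<And>n. (\<Sum>k<n. first_return_sum (\<lambda>y. \<beta> * V\<^sub>0 K y) ?J (Suc k) x) \<le> q"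
    using less unfolding induced_transfer_less_1_iff by blast
  \<comment> \<open>The value \<open>1 / 2\<close> only guards against \<open>q \<le> 0\<close>; what matters is \<open>exp s * q \<le> 1\<close>.\<close>
  define s where "s = - ln (max q (1 / 2))"
  have s: "0 < s" using q(1) by (simp add: s_def)
  have "exp s * q \<le> exp s * max q (1 / 2)" by (rule mult_left_mono) auto
  also have "\<dots> = 1" by (simp add: s_def exp_minus)
  finally have qs: "exp s * q \<le> 1" .
  define g where "g x = \<beta> * V\<^sub>0 K x + s * indicator ?J x" for x
  define B where "B = \<beta> * ln 2 + s"
  have g_low: "- (\<beta> * ln 2) \<le> g z" and g_high: "g z \<le> s" for z
  proof -
    have "\<beta> * \<phi>\<^sub>0 K z \<le> \<beta> * ln 2" "0 \<le> \<beta> * \<phi>\<^sub>0 K z"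
      using \<beta> phi_le_ln2[OF K] phi_nonneg[OF K] by (auto intro: mult_left_mono)
    moreover have "0 \<le> s * indicator ?J z" "s * indicator ?J z \<le> s"
      using s by (auto simp: indicator_def)
    ultimately show "- (\<beta> * ln 2) \<le> g z" "g z \<le> s"
      by (simp_all add: g_def V0_eq)
  qed
  have g_bound: "\<bar>g z\<bar> \<le> B" for z
  proof -
    have "0 \<le> \<beta> * ln 2" using \<beta> by simp
    then show ?thesis using g_low[of z] g_high[of z] s by (simp add: B_def abs_le_iff)
  qed
  have scr: "screened ?J g"
    unfolding screened_def
  proof (intro allI ballI)
    fix u :: "'a list" and y y' assume y: "y \<in> ?J" "y' \<in> ?J"
    have "\<phi>\<^sub>0 K (prepend u y) = \<phi>\<^sub>0 K (prepend u y')"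
      by (rule screenedD[OF screened_phi[OF K w] y])
    moreover have "(prepend u y \<in> ?J) = (prepend u y' \<in> ?J)"
      by (rule screenedD[OF screened_mem_cylinder y])
    ultimately show "g (prepend u y) = g (prepend u y')"
      by (simp add: g_def V0_eq indicator_def)
  qed
  have first: "(\<Sum>k<n. first_return_sum g ?J (Suc k) x) \<le> 1" for n
  proof -
    have "(\<Sum>k<n. first_return_sum g ?J (Suc k) x) =
        exp s * (\<Sum>k<n. first_return_sum (\<lambda>y. \<beta> * V\<^sub>0 K y) ?J (Suc k) x)"
      unfolding g_def first_return_sum_bonus sum_distrib_left ..
    also have "\<dots> \<le> exp s * q" by (intro mult_left_mono q) simp
    finally show ?thesis using qs by simp
  qed
  have ret: "return_sum g ?J n x \<le> 1" for n
    by (rule renewal_le_1[OF return_sum_0[OF x] return_sum_renewal[OF scr x]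
          first_return_sum_nonneg first])
  have words: "(\<Sum>u\<in>words n. exp (birkhoff_sum n g (prepend u x))) \<le> exp (?m * (\<beta> * ln 2))" for n
  proof -
    have "(\<Sum>u\<in>words n. exp (birkhoff_sum n g (prepend (u @ []) x)))
        \<le> exp ((length w + length ([] :: 'a list)) * (\<beta> * ln 2)) *
          return_sum g ?J (length w + n + length ([] :: 'a list)) x"
      by (rule sum_prepend_le_return_sum) (rule g_low, rule subset_refl)
    also have "\<dots> \<le> exp (?m * (\<beta> * ln 2)) * 1"
      using mult_left_mono[OF ret[of "length w + n"], of "exp (?m * (\<beta> * ln 2))"] by simp
    finally show ?thesis by simp
  qed
  \<comment> \<open>The Birkhoff sum with \<open>u\<close> continued by \<open>x\<close>, plus what any other continuation may add.\<close>
  define W where "W u = birkhoff_sum (length u) g (prepend u x)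
    + (\<beta> * ln ((real (length u) + 2) / 2) + s * ?m)" for u
  define c where "c n = ?m * (\<beta> * ln 2) + (\<beta> * ln ((real n + 2) / 2) + s * ?m)" for n
  have dom: "birkhoff_sum n g y \<le> W (initial n y)" for n y
  proof -
    let ?y = "prepend (initial n y) x"
    have eq: "initial n y = initial n ?y" by simp
    have split: "birkhoff_sum n g z = - (\<beta> * birkhoff_sum n (\<phi>\<^sub>0 K) z)
        + s * birkhoff_sum n (indicator ?J) z" for z
      by (simp add: g_def V0_eq birkhoff_sum_def sum.distrib sum_distrib_left sum_subtractf)
    have "\<beta> * birkhoff_sum n (\<phi>\<^sub>0 K) ?y \<le> \<beta> * (birkhoff_sum n (\<phi>\<^sub>0 K) y + ln ((real n + 2) / 2))"
      by (rule mult_left_mono[OF birkhoff_sum_phi_shadow[OF K eq] \<beta>])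
    moreover have "s * birkhoff_sum n (indicator ?J) y \<le> s * (birkhoff_sum n (indicator ?J) ?y + ?m)"
      by (rule mult_left_mono[OF birkhoff_sum_indicator_cylinder[OF eq]]) (use s in simp)
    moreover have "W (initial n y) = birkhoff_sum n g ?y + (\<beta> * ln ((real n + 2) / 2) + s * ?m)"
      by (simp add: W_def)
    ultimately show ?thesis
      unfolding split by (simp add: algebra_simps)
  qed
  have wt: "(\<Sum>u\<in>words n. exp (W u)) \<le> exp (c n)" for n
  proof -
    have "(\<Sum>u\<in>words n. exp (W u)) = (\<Sum>u\<in>words n. exp (birkhoff_sum n g (prepend u x)))
        * exp (\<beta> * ln ((real n + 2) / 2) + s * ?m)"
      unfolding sum_distrib_right by (intro sum.cong refl) (simp add: W_def words_def exp_add)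
    also have "\<dots> \<le> exp (?m * (\<beta> * ln 2)) * exp (\<beta> * ln ((real n + 2) / 2) + s * ?m)"
      by (rule mult_right_mono[OF words]) simp
    finally show ?thesis by (simp add: c_def exp_add)
  qed
  have "(\<lambda>n. (?m * (\<beta> * ln 2) + s * ?m) * (1 / real n) + \<beta> * (ln ((real n + 2) / 2) / real n))
      \<longlonglongrightarrow> (?m * (\<beta> * ln 2) + s * ?m) * 0 + \<beta> * 0"
    by (intro tendsto_add tendsto_mult tendsto_const; real_asymp)
  then have clim: "(\<lambda>n. c n / real n) \<longlonglongrightarrow> 0"
    by (simp add: c_def add_divide_distrib algebra_simps)
  have g_meas: "g \<in> borel_measurable seq_borel"
    unfolding g_def V0_eq
    by (intro borel_measurable_add borel_measurable_times borel_measurable_const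
        borel_measurable_uminus phi_measurable[OF K] borel_measurable_indicator cylinder_in_sets)
  have "kolmogorov_entropy \<mu> \<le> ereal (\<beta> * (\<integral>x. \<phi>\<^sub>0 K x \<partial>\<mu>) - s * measure \<mu> ?J)"
    if \<mu>: "invariant_measure \<mu>" for \<mu>
  proof -
    note m = invariant_measure_sets[OF \<mu>]
    interpret prob_space \<mu> by (rule m)
    have J: "?J \<in> sets \<mu>" using cylinder_in_sets m(2) by simp
    have "(\<integral>x. g x \<partial>\<mu>) = (\<integral>x. s * indicator ?J x - \<beta> * \<phi>\<^sub>0 K x \<partial>\<mu>)"
      by (simp add: g_def V0_eq)
    also have "\<dots> = (\<integral>x. s * indicator ?J x \<partial>\<mu>) - (\<integral>x. \<beta> * \<phi>\<^sub>0 K x \<partial>\<mu>)"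
      using J by (intro Bochner_Integration.integral_diff integrable_mult_right integrable_phi[OF K \<mu>]
          integrable_real_indicator) (simp_all add: emeasure_eq_measure)
    also have "\<dots> = s * measure \<mu> ?J - \<beta> * (\<integral>x. \<phi>\<^sub>0 K x \<partial>\<mu>)"
      using J m(3) by simp
    finally show ?thesis
      using kolmogorov_entropy_le[OF \<mu> g_meas g_bound dom wt clim] by simp
  qed
  then show ?thesis by (rule that[OF s])
qed

text \<open>Since \<open>V\<^sub>0 \<le> 0\<close>, the bound at \<open>\<beta>\<^sub>0\<close> persists for larger \<open>\<beta>\<close>.\<close>

lemma free_energy_bound:
  fixes K :: "'a::finite seq set"
  assumes K: "subshift K" and w: "cylinder w \<inter> K = {}" and \<beta>\<^sub>0: "0 < \<beta>\<^sub>0"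
    and less: "\<forall>x\<in>cylinder w. induced_transfer (cylinder w) 0 \<beta>\<^sub>0 (V\<^sub>0 K) (indicator (cylinder w)) x < 1"
  obtains s where "0 < s"
    "\<And>\<beta> \<mu>. \<beta>\<^sub>0 \<le> \<beta> \<Longrightarrow> invariant_measure \<mu> \<Longrightarrow>
      free_energy (V\<^sub>0 K) \<beta> \<mu> \<le> ereal (- (s * measure \<mu> (cylinder w)))"
proof -
  let ?x = "prepend w undefined"
  have x: "?x \<in> cylinder w" by simp
  obtain s where s: "0 < s" "\<And>\<mu>. invariant_measure \<mu> \<Longrightarrow>
      kolmogorov_entropy \<mu> \<le> ereal (\<beta>\<^sub>0 * (\<integral>x. \<phi>\<^sub>0 K x \<partial>\<mu>) - s * measure \<mu> (cylinder w))"
    by (rule entropy_bound_with_bonus[OF K w less_imp_le[OF \<beta>\<^sub>0] x less[rule_format, OF x]]) blast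
  have "free_energy (V\<^sub>0 K) \<beta> \<mu> \<le> ereal (- (s * measure \<mu> (cylinder w)))"
    if \<beta>: "\<beta>\<^sub>0 \<le> \<beta>" and \<mu>: "invariant_measure \<mu>" for \<beta> \<mu>
  proof -
    let ?I = "\<integral>x. \<phi>\<^sub>0 K x \<partial>\<mu>"
    have "free_energy (V\<^sub>0 K) \<beta> \<mu> = kolmogorov_entropy \<mu> + ereal (- (\<beta> * ?I))"
      by (simp add: free_energy_def V0_eq)
    also have "\<dots> \<le> ereal (\<beta>\<^sub>0 * ?I - s * measure \<mu> (cylinder w)) + ereal (- (\<beta> * ?I))"
      by (intro add_right_mono s \<mu>)
    also have "\<dots> \<le> ereal (- (s * measure \<mu> (cylinder w)))"
      using mult_right_mono[OF \<beta> integral_phi_nonneg[OF K, of \<mu>]] by simp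
    finally show ?thesis .
  qed
  then show ?thesis by (rule that[OF s(1)])
qed

lemma periodic_invariant_measure:
  fixes p :: "'a::finite seq"
  assumes N: "0 < N" and p: "(shift ^^ N) p = p"
  obtains \<mu> where "invariant_measure \<mu>"
    "\<And>f. f \<in> borel_measurable seq_borel \<Longrightarrow> (\<integral>x. f x \<partial>\<mu>) = birkhoff_sum N f p / real N"
proof
  let ?q = "pmf_of_set {..<N}"
  define \<mu> where "\<mu> = distr (measure_pmf ?q) seq_borel (\<lambda>k. (shift ^^ k) p)"
  have ne: "{..<N} \<noteq> {}" "finite {..<N}" using N by auto
  have bij: "bij_betw (\<lambda>k. Suc k mod N) {..<N} {..<N}"
  proof -
    have inj: "inj_on (\<lambda>k. Suc k mod N) {..<N}"
      by (rule inj_onI) (auto simp: mod_Suc split: if_splits)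
    have "(\<lambda>k. Suc k mod N) ` {..<N} \<subseteq> {..<N}" using N by auto
    then have "(\<lambda>k. Suc k mod N) ` {..<N} = {..<N}"
      by (intro endo_inj_surj inj) auto
    with inj show ?thesis by (simp add: bij_betw_def)
  qed
  have period: "(shift ^^ (k mod N)) p = (shift ^^ k) p" for k
  proof -
    have "((shift ^^ N) ^^ j) p = p" for j
      by (induction j) (simp_all add: p)
    then have "(shift ^^ (k mod N + N * (k div N))) p = (shift ^^ (k mod N)) p"
      by (simp only: funpow_add funpow_mult[symmetric] comp_def)
    then show ?thesis by simp
  qed
  have "distr \<mu> \<mu> shift = distr \<mu> seq_borel shift"
    by (rule distr_cong) (simp_all add: \<mu>_def)
  also have "\<dots> = distr (measure_pmf ?q) seq_borel (\<lambda>k. (shift ^^ Suc k) p)"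
    unfolding \<mu>_def by (subst distr_distr) (simp_all add: measurable_shift comp_def)
  also have "\<dots> = distr (measure_pmf ?q) seq_borel ((\<lambda>k. (shift ^^ k) p) \<circ> (\<lambda>k. Suc k mod N))"
    by (rule distr_cong) (simp_all add: comp_def period del: funpow.simps)
  also have "\<dots> = distr (measure_pmf (map_pmf (\<lambda>k. Suc k mod N) ?q)) seq_borel (\<lambda>k. (shift ^^ k) p)"
    unfolding map_pmf_rep_eq by (subst distr_distr) simp_all
  also have "map_pmf (\<lambda>k. Suc k mod N) ?q = ?q"
    by (rule map_pmf_of_set_bij_betw[OF bij ne])
  finally have inv: "distr \<mu> \<mu> shift = \<mu>" by (simp add: \<mu>_def)
  have "prob_space \<mu>"
    unfolding \<mu>_def by (rule prob_space.prob_space_distr[OF prob_space_measure_pmf]) simp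
  with inv show "invariant_measure \<mu>"
    by (simp add: invariant_measure_def \<mu>_def)
  fix f :: "'a seq \<Rightarrow> real" assume f: "f \<in> borel_measurable seq_borel"
  have "(\<integral>x. f x \<partial>\<mu>) = (\<integral>k. f ((shift ^^ k) p) \<partial>measure_pmf ?q)"
    unfolding \<mu>_def by (rule integral_distr[OF _ f]) simp
  also have "\<dots> = birkhoff_sum N f p / real N"
    by (subst integral_pmf_of_set[OF ne]) (simp add: birkhoff_sum_def)
  finally show "(\<integral>x. f x \<partial>\<mu>) = birkhoff_sum N f p / real N" .
qed

text \<open>Repeating the first \<open>N\<close> letters of a point of \<open>K\<close> periodically gives an orbit along which the
potential has average at most \<open>ln ((N + 2) / 2) / N\<close> in absolute value. As entropy is nonnegative, the
free energies of these orbit measures have limit inferior at least \<open>0\<close>.\<close>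

lemma pressure_nonneg:
  fixes K :: "'a::finite seq set"
  assumes K: "subshift K" and \<beta>: "0 \<le> \<beta>"
  shows "0 \<le> pressure (V\<^sub>0 K) \<beta>"
proof -
  obtain x where x: "x \<in> K" using K by (auto simp: subshift_def)
  have bound: "ereal (- (\<beta> * (ln ((real N + 2) / 2) / real N))) \<le> pressure (V\<^sub>0 K) \<beta>" if N: "1 \<le> N" for N
  proof -
    define p where "p = (\<lambda>i. x (i mod N))"
    have p: "(shift ^^ N) p = p" by (simp add: p_def shift_funpow)
    have "0 < N" using N by simp
    from this p obtain \<mu> where \<mu>: "invariant_measure \<mu>"
      "\<And>f. f \<in> borel_measurable seq_borel \<Longrightarrow> (\<integral>x. f x \<partial>\<mu>) = birkhoff_sum N f p / real N"
      by (rule periodic_invariant_measure) blast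
    have "initial N x = initial N p" by (simp add: initial_eq_iff p_def)
    from birkhoff_sum_phi_shadow[OF K this]
    have "birkhoff_sum N (\<phi>\<^sub>0 K) p \<le> birkhoff_sum N (\<phi>\<^sub>0 K) x + ln ((real N + 2) / 2)" .
    also have "birkhoff_sum N (\<phi>\<^sub>0 K) x = 0"
      using shift_funpow_subshift[OF K x] by (simp add: birkhoff_sum_def \<phi>\<^sub>0_def)
    finally have "(\<integral>x. \<phi>\<^sub>0 K x \<partial>\<mu>) \<le> ln ((real N + 2) / 2) / real N"
      unfolding \<mu>(2)[OF phi_measurable[OF K]] using N by (simp add: divide_right_mono)
    then have "\<beta> * (\<integral>x. \<phi>\<^sub>0 K x \<partial>\<mu>) \<le> \<beta> * (ln ((real N + 2) / 2) / real N)"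
      by (rule mult_left_mono) (rule \<beta>)
    then have "0 + ereal (- (\<beta> * (ln ((real N + 2) / 2) / real N)))
        \<le> kolmogorov_entropy \<mu> + ereal (\<beta> * (\<integral>x. V\<^sub>0 K x \<partial>\<mu>))"
      by (intro add_mono kolmogorov_entropy_nonneg[OF \<mu>(1)]) (simp add: V0_eq)
    also have "\<dots> = free_energy (V\<^sub>0 K) \<beta> \<mu>" by (simp add: free_energy_def)
    also have "\<dots> \<le> pressure (V\<^sub>0 K) \<beta>"
      unfolding pressure_def using \<mu>(1) by (intro SUP_upper) simp
    finally show ?thesis by simp
  qed
  have "(\<lambda>N. - (\<beta> * (ln ((real N + 2) / 2) / real N))) \<longlonglongrightarrow> - (\<beta> * 0)"
    by (intro tendsto_minus tendsto_mult tendsto_const; real_asymp)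
  then have "(\<lambda>N. ereal (- (\<beta> * (ln ((real N + 2) / 2) / real N)))) \<longlonglongrightarrow> ereal 0"
    by simp
  then have "ereal 0 \<le> pressure (V\<^sub>0 K) \<beta>"
    by (rule LIMSEQ_le_const2) (use bound in blast)
  then show ?thesis by (simp add: zero_ereal_def)
qed

text \<open>A measure that charges the cylinder has negative free energy, whereas the pressure is nonnegative.\<close>

lemma equilibrium_measure_null:
  fixes K :: "'a::finite seq set"
  assumes K: "subshift K" and w: "cylinder w \<inter> K = {}" and \<beta>\<^sub>0: "0 < \<beta>\<^sub>0"
    and less: "\<forall>x\<in>cylinder w. induced_transfer (cylinder w) 0 \<beta>\<^sub>0 (V\<^sub>0 K) (indicator (cylinder w)) x < 1"
    and \<beta>: "\<beta>\<^sub>0 \<le> \<beta>" and \<mu>: "equilibrium_measure (V\<^sub>0 K) \<beta> \<mu>"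
  shows "emeasure \<mu> (cylinder w) = 0"
proof -
  obtain s where s: "0 < s" "\<And>\<beta> \<mu>. \<beta>\<^sub>0 \<le> \<beta> \<Longrightarrow> invariant_measure \<mu> \<Longrightarrow>
      free_energy (V\<^sub>0 K) \<beta> \<mu> \<le> ereal (- (s * measure \<mu> (cylinder w)))"
    by (rule free_energy_bound[OF K w \<beta>\<^sub>0 less]) blast
  have inv: "invariant_measure \<mu>" and eq: "free_energy (V\<^sub>0 K) \<beta> \<mu> = pressure (V\<^sub>0 K) \<beta>"
    using \<mu> by (auto simp: equilibrium_measure_def)
  interpret prob_space \<mu> by (rule invariant_measure_sets[OF inv])
  have "0 \<le> pressure (V\<^sub>0 K) \<beta>" using pressure_nonneg[OF K] \<beta>\<^sub>0 \<beta> by simp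
  also have "\<dots> \<le> ereal (- (s * measure \<mu> (cylinder w)))" using s(2)[OF \<beta> inv] eq by simp
  finally have "s * measure \<mu> (cylinder w) \<le> 0" by simp
  then have "measure \<mu> (cylinder w) = 0"
    using s(1) by (simp add: mult_le_0_iff measure_le_0_iff)
  then show ?thesis by (simp add: emeasure_eq_measure)
qed

lemma pressure_eq_0:
  fixes K :: "'a::finite seq set"
  assumes K: "subshift K" and w: "cylinder w \<inter> K = {}" and \<beta>\<^sub>0: "0 < \<beta>\<^sub>0"
    and less: "\<forall>x\<in>cylinder w. induced_transfer (cylinder w) 0 \<beta>\<^sub>0 (V\<^sub>0 K) (indicator (cylinder w)) x < 1"
    and \<beta>: "\<beta>\<^sub>0 \<le> \<beta>"
  shows "pressure (V\<^sub>0 K) \<beta> = 0"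
proof (rule antisym)
  obtain s where s: "0 < s" "\<And>\<beta> \<mu>. \<beta>\<^sub>0 \<le> \<beta> \<Longrightarrow> invariant_measure \<mu> \<Longrightarrow>
      free_energy (V\<^sub>0 K) \<beta> \<mu> \<le> ereal (- (s * measure \<mu> (cylinder w)))"
    by (rule free_energy_bound[OF K w \<beta>\<^sub>0 less]) blast
  show "pressure (V\<^sub>0 K) \<beta> \<le> 0"
    unfolding pressure_def
  proof (rule SUP_least)
    fix \<mu> assume "\<mu> \<in> {\<mu> :: 'a seq measure. invariant_measure \<mu>}"
    then have "free_energy (V\<^sub>0 K) \<beta> \<mu> \<le> ereal (- (s * measure \<mu> (cylinder w)))"
      using s(2)[OF \<beta>] by simp
    also have "\<dots> \<le> 0" using s(1) by simp
    finally show "free_energy (V\<^sub>0 K) \<beta> \<mu> \<le> 0" .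
  qed
  show "0 \<le> pressure (V\<^sub>0 K) \<beta>" using pressure_nonneg[OF K] \<beta>\<^sub>0 \<beta> by simp
qed

text \<open>The complement of \<open>K\<close> is open, hence a countable union of cylinders.\<close>

lemma carried_by_subshift:
  fixes K :: "'a::finite seq set"
  assumes K: "subshift K" and \<mu>: "invariant_measure \<mu>"
    and null: "\<And>w. cylinder w \<inter> K = {} \<Longrightarrow> emeasure \<mu> (cylinder w) = 0"
  shows "emeasure \<mu> K = 1"
proof -
  note s = invariant_measure_sets[OF \<mu>]
  interpret prob_space \<mu> by (rule s)
  let ?C = "{cylinder w | w. cylinder w \<subseteq> - K}"
  have "- K = \<Union> ?C"
    by (rule open_eq_Union_cylinders[OF openin_Compl_subshift[OF K]])
  moreover have "(\<Union>C\<in>?C. C) \<in> null_sets \<mu>"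
  proof (rule null_sets_UN')
    show "countable ?C" by (rule countable_subset[OF _ countable_cylinders]) blast
    fix C assume "C \<in> ?C"
    then obtain w where w: "C = cylinder w" "cylinder w \<inter> K = {}" by blast
    then show "C \<in> null_sets \<mu>"
      using null cylinder_in_sets[of w] by (simp add: null_sets_def s(2))
  qed
  ultimately have N: "- K \<in> null_sets \<mu>" by simp
  have "emeasure \<mu> (space \<mu> - - K) = emeasure \<mu> (space \<mu>)"
    by (rule emeasure_Diff_null_set[OF N]) simp
  then show ?thesis by (simp add: s(3) emeasure_space_1[unfolded s(3)])
qed

lemma free_energy_on_subshift_nonneg:
  fixes K :: "'a::finite seq set"
  assumes \<mu>: "invariant_measure_on K \<mu>"
  shows "0 \<le> free_energy (V\<^sub>0 K) \<beta> \<mu>"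
proof -
  have inv: "invariant_measure \<mu>" and K1: "emeasure \<mu> K = 1"
    using \<mu> by (auto simp: invariant_measure_on_def)
  interpret prob_space \<mu> by (rule invariant_measure_sets[OF inv])
  have "prob K = 1" using K1 by (simp add: measure_def)
  then have "AE x in \<mu>. V\<^sub>0 K x = 0"
    by (rule AE_mp[OF AE_prob_1]) (simp add: V0_eq \<phi>\<^sub>0_def)
  then have "(\<integral>x. V\<^sub>0 K x \<partial>\<mu>) = 0" by (rule integral_eq_zero_AE)
  then show ?thesis
    using kolmogorov_entropy_nonneg[OF inv] by (simp add: free_energy_def)
qed

theorem theorem2:
  fixes K J :: "('a::finite) seq set" and \<beta>\<^sub>0 :: real
  assumes "CARD('a) \<ge> 2"
    and "subshift K"
    and "subshift_entropy K = 0"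
    and "\<exists>w. J = cylinder w"
    and "J \<inter> K = {}"
    and "\<beta>\<^sub>0 > 0"
    and "\<forall>x\<in>J. induced_transfer J 0 \<beta>\<^sub>0 (V\<^sub>0 K) (indicator J) x < 1"
  shows "(\<forall>\<beta>\<ge>\<beta>\<^sub>0. \<forall>\<mu>. equilibrium_measure (V\<^sub>0 K) \<beta> \<mu> \<longrightarrow> emeasure \<mu> J = 0) \<and>
    (\<forall>\<mu>\<^sub>K. minimal_subshift K \<and> uniquely_ergodic K \<and> invariant_measure_on K \<mu>\<^sub>K \<longrightarrow>
       (\<forall>w. cylinder w \<inter> K = {} \<longrightarrow>
          (\<forall>x\<in>cylinder w.
             induced_transfer (cylinder w) 0 \<beta>\<^sub>0 (V\<^sub>0 K) (indicator (cylinder w)) x < 1) \<and>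
          (\<forall>\<beta>\<ge>\<beta>\<^sub>0. \<forall>\<mu>. equilibrium_measure (V\<^sub>0 K) \<beta> \<mu> \<longrightarrow> emeasure \<mu> (cylinder w) = 0)) \<and>
       (\<forall>\<beta>\<ge>\<beta>\<^sub>0. (\<forall>\<mu>. equilibrium_measure (V\<^sub>0 K) \<beta> \<mu> \<longleftrightarrow> \<mu> = \<mu>\<^sub>K) \<and>
          pressure (V\<^sub>0 K) \<beta> = 0))"
proof -
  note K = assms(2) and pos = assms(6)
  obtain w\<^sub>0 where J: "J = cylinder w\<^sub>0" using assms(4) by blast
  note disj = assms(5)[unfolded J] and less = assms(7)[unfolded J]
  have other: "\<forall>x\<in>cylinder w. induced_transfer (cylinder w) 0 \<beta>\<^sub>0 (V\<^sub>0 K) (indicator (cylinder w)) x < 1"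
    if w: "cylinder w \<inter> K = {}" for w
  proof
    fix x assume x: "x \<in> cylinder w"
    have scr: "screened (cylinder v) (V\<^sub>0 K)" if "cylinder v \<inter> K = {}" for v
      using screenedD[OF screened_phi[OF K that]] unfolding screened_def V0_eq by metis
    have low: "- (\<beta>\<^sub>0 * ln 2) \<le> \<beta>\<^sub>0 * V\<^sub>0 K z" for z
      using mult_left_mono[OF phi_le_ln2[OF K, of z] less_imp_le[OF pos]] by (simp add: V0_eq)
    show "induced_transfer (cylinder w) 0 \<beta>\<^sub>0 (V\<^sub>0 K) (indicator (cylinder w)) x < 1"
      by (rule induced_transfer_less_1_other_cylinder[OF low scr[OF disj] scr[OF w] prepend_in_cylinder x
            less[rule_format, OF prepend_in_cylinder]])
  qed
  note null = equilibrium_measure_null[OF K _ pos other]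
  note zero = pressure_eq_0[OF K disj pos less]
  have unique: "equilibrium_measure (V\<^sub>0 K) \<beta> \<mu> \<longleftrightarrow> \<mu> = \<mu>\<^sub>K"
    if "uniquely_ergodic K" and \<mu>\<^sub>K: "invariant_measure_on K \<mu>\<^sub>K" and \<beta>: "\<beta>\<^sub>0 \<le> \<beta>" for \<mu>\<^sub>K \<beta> \<mu>
  proof
    assume \<mu>: "equilibrium_measure (V\<^sub>0 K) \<beta> \<mu>"
    then have inv: "invariant_measure \<mu>" by (simp add: equilibrium_measure_def)
    have "emeasure \<mu> K = 1"
      by (rule carried_by_subshift[OF K inv]) (rule null[OF _ _ \<beta> \<mu>])
    with inv have "invariant_measure_on K \<mu>" by (simp add: invariant_measure_on_def)
    then show "\<mu> = \<mu>\<^sub>K"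
      using that(1) \<mu>\<^sub>K unfolding uniquely_ergodic_def by blast
  next
    assume "\<mu> = \<mu>\<^sub>K"
    then have inv: "invariant_measure \<mu>" and ge: "0 \<le> free_energy (V\<^sub>0 K) \<beta> \<mu>"
      using \<mu>\<^sub>K free_energy_on_subshift_nonneg by (auto simp: invariant_measure_on_def)
    have "free_energy (V\<^sub>0 K) \<beta> \<mu> \<le> pressure (V\<^sub>0 K) \<beta>"
      unfolding pressure_def using inv by (intro SUP_upper) simp
    then show "equilibrium_measure (V\<^sub>0 K) \<beta> \<mu>"
      using inv ge zero[OF \<beta>] by (simp add: equilibrium_measure_def)
  qed
  show ?thesis
  proof (intro conjI allI impI)
    fix \<beta> \<mu> assume "\<beta>\<^sub>0 \<le> \<beta>" "equilibrium_measure (V\<^sub>0 K) \<beta> \<mu>"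
    then show "emeasure \<mu> J = 0"
      unfolding J by (rule equilibrium_measure_null[OF K disj pos less])
  qed (use other null zero unique in blast)+
qed

end
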